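(* Let $(M_\Delta,J_\Delta,\omega_\Delta)$ be the canonical toric Kähler manifold associated with a Delzant polytope $\Delta$. Then $\omega_\Delta$ has positive holomorphic sectional curvature, $\operatorname{HSC}>0$.
   Context: A polytope $\Delta\subset(\mathbb R^n)^*$ (convex hull of finitely many points) is Delzant if at each vertex exactly $n$ edges meet and these edges have primitive integral directions $u_1,\dots,u_n$ forming a $\mathbb Z$-basis of the lattice $(\mathbb Z^n)^*$. Write $\Delta=\{x\in(\mathbb R^n)^*\mid \langle x,v_i\rangle\le\lambda_i,\ i=1,\dots,d\}$, where $v_1,\dots,v_d\in\mathbb Z^n$ are the primitive outward normals to the facets of $\Delta$. Canonical toric Kähler manifold (Delzant's construction). Let $\pi:\mathbb R^d\to\mathbb R^n$, $\pi(e_i)=v_i$. Then $\pi(\mathbb Z^d)=\mathbb Z^n$, so $\pi$ induces a surjection $\Pi:\mathbb T^d=\mathbb R^d/\mathbb Z^d\to\mathbb T^n=\mathbb R^n/\mathbb Z^n$. Put $N=\ker\Pi$, with Lie algebra $\mathfrak n=\ker\pi$, let $\iota:\mathfrak n\to\mathbb R^d$ be the inclusion and $\iota^*:(\mathbb R^d)^*\to\mathfrak n^*$ its dual. $\mathbb T^d$ acts on $\mathbb C^d$ in the standard diagonal way by rotation of the coordinates. Define $\phi(z)=-\tfrac12(|z_1|^2,\dots,|z_d|^2)+(\lambda_1,\dots,\lambda_d)\in(\mathbb R^d)^*$, $\phi_N=\iota^*\circ\phi:\mathbb C^d\to\mathfrak n^*$ (the moment map for the $N$-action), and $Z=\phi_N^{-1}(0)$.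 It is known that $Z$ is a compact smooth submanifold on which $N$ acts freely. Set $M_\Delta=Z/N$. Let $(\mathbb C^d,J_0,g_0,\omega_0)$ be the standard flat Kähler structure. For $z\in Z$ let $\mathcal V_z\subset T_zZ$ be the tangent space to the $N$-orbit and $\mathcal H_z=\mathcal V_z^{\perp_{g_0}}\cap T_zZ$, which is $J_0$-invariant. The metric $g_\Delta$ and complex structure $J_\Delta$ on $M_\Delta$ are obtained by identifying $T_{[z]}M_\Delta$ with $\mathcal H_z$ via the differential of the quotient map $q:Z\to M_\Delta$ and restricting $g_0$ and $J_0$ to $\mathcal H_z$; $\omega_\Delta$ is determined by $q^*\omega_\Delta=\omega_0|_Z$. Then $(M_\Delta,J_\Delta,g_\Delta,\omega_\Delta)$ is a compact Kähler manifold. For a Kähler manifold with complex structure $J$, metric $g$ and Riemannian curvature tensor $R$ (sign convention such that round spheres have positive curvature $R(V,W,W,V)$), the holomorphic sectional curvature of a nonzero tangent vector $V$ is $R(V,JV,JV,V)/\|V\|^4$; $\operatorname{HSC}>0$ means that it is positive for every nonzero tangent vector at every point. *)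

theory Defs
  imports "HOL-Analysis.Analysis"
begin

section \<open>Riemannian and Kaehler geometry in a coordinate domain\<close>

abbreviation dir_deriv ::
    "('a::real_normed_vector \<Rightarrow> 'b::real_normed_vector) \<Rightarrow> 'a \<Rightarrow> 'a \<Rightarrow> 'b"
  where "dir_deriv f x u \<equiv> frechet_derivative f (at x) u"

primrec Ck_on ::
    "nat \<Rightarrow> 'a::real_normed_vector set \<Rightarrow> ('a \<Rightarrow> 'b::real_normed_vector) \<Rightarrow> bool"
  where
    "Ck_on 0 U f \<longleftrightarrow> continuous_on U f"
  | "Ck_on (Suc k) U f \<longleftrightarrow>
       (\<forall>x\<in>U. f differentiable (at x)) \<and> (\<forall>u. Ck_on k U (\<lambda>x. dir_deriv f x u))"

text \<open>Only meaningful for open \<open>U\<close>, since derivatives are taken in the ambient space.\<close>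

definition smooth_on :: "'a::real_normed_vector set \<Rightarrow> ('a \<Rightarrow> 'b::real_normed_vector) \<Rightarrow> bool"
  where "smooth_on U f \<longleftrightarrow> (\<forall>k. Ck_on k U f)"

text \<open>A metric on a coordinate domain is a function \<open>g x u w\<close>, with \<open>x\<close> the base point
  and \<open>u\<close>, \<open>w\<close> coordinate tangent vectors.  The vector \<open>christoffel g x u w\<close> is the
  Levi-Civita derivative at \<open>x\<close> of the constant vector field \<open>w\<close> in direction \<open>u\<close>, given by
  the Koszul formula (constant vector fields commute).\<close>

definition christoffel :: "('e::euclidean_space \<Rightarrow> 'e \<Rightarrow> 'e \<Rightarrow> real) \<Rightarrow> 'e \<Rightarrow> 'e \<Rightarrow> 'e \<Rightarrow> 'e"
  where "christoffel g x u w =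
    (THE c. \<forall>a. g x c a =
       (dir_deriv (\<lambda>y. g y w a) x u + dir_deriv (\<lambda>y. g y u a) x w
         - dir_deriv (\<lambda>y. g y u w) x a) / 2)"

definition curvature_op ::
    "('e::euclidean_space \<Rightarrow> 'e \<Rightarrow> 'e \<Rightarrow> real) \<Rightarrow> 'e \<Rightarrow> 'e \<Rightarrow> 'e \<Rightarrow> 'e \<Rightarrow> 'e"
  where "curvature_op g x u v w =
    dir_deriv (\<lambda>y. christoffel g y v w) x u + christoffel g x u (christoffel g x v w)
    - (dir_deriv (\<lambda>y. christoffel g y u w) x v + christoffel g x v (christoffel g x u w))"

text \<open>\<open>curvature_op\<close> is \<open>R(u,v)w = D_u D_v w - D_v D_u w\<close> on constant fields; with
  \<open>R(a,b,c,d) = g(R(a,b)c, d)\<close>, round spheres have \<open>R(v,w,w,v) > 0\<close>.\<close>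

definition riemann_tensor ::
    "('e::euclidean_space \<Rightarrow> 'e \<Rightarrow> 'e \<Rightarrow> real) \<Rightarrow> 'e \<Rightarrow> 'e \<Rightarrow> 'e \<Rightarrow> 'e \<Rightarrow> 'e \<Rightarrow> real"
  where "riemann_tensor g x a b c d = g x (curvature_op g x a b c) d"

definition hol_sect_curv ::
    "('e::euclidean_space \<Rightarrow> 'e \<Rightarrow> 'e \<Rightarrow> real) \<Rightarrow> ('e \<Rightarrow> 'e \<Rightarrow> 'e) \<Rightarrow> 'e \<Rightarrow> 'e \<Rightarrow> real"
  where "hol_sect_curv g J x V =
    riemann_tensor g x V (J x V) (J x V) V / sqrt (g x V V) ^ 4"

text \<open>For an embedded submanifold \<open>S\<close> this is its tangent space at \<open>z\<close>: the velocities at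
  \<open>z\<close> of curves in \<open>S\<close>.\<close>

definition tangent_space :: "'a::real_normed_vector set \<Rightarrow> 'a \<Rightarrow> 'a set"
  where "tangent_space S z =
    {w. \<exists>\<gamma>::real \<Rightarrow> 'a. range \<gamma> \<subseteq> S \<and> \<gamma> 0 = z \<and> (\<gamma> has_vector_derivative w) (at 0)}"


section \<open>Delzant polytopes\<close>

text \<open>\<open>(R^n)\<^sup>*\<close> is identified with \<open>R^n\<close> by the standard inner product, which is then the
  pairing, and which identifies the dual lattice with \<open>Z^n\<close>.\<close>

definition int_lattice :: "(real ^ 'n) set"
  where "int_lattice = {x. \<forall>i. x $ i \<in> \<int>}"

definition primitive_vector :: "real ^ 'n \<Rightarrow> bool"
  where "primitive_vector v \<longleftrightarrow> v \<in> int_lattice \<and> v \<noteq> 0 \<and>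
    (\<forall>w\<in>int_lattice. \<forall>k::int. v = of_int k *\<^sub>R w \<longrightarrow> \<bar>k\<bar> = 1)"

definition lattice_basis :: "('n \<Rightarrow> real ^ 'n) \<Rightarrow> bool"
  where "lattice_basis u \<longleftrightarrow> (\<forall>i. u i \<in> int_lattice) \<and>
    (\<forall>y\<in>int_lattice. \<exists>!c::'n \<Rightarrow> int. y = (\<Sum>i\<in>UNIV. of_int (c i) *\<^sub>R u i))"

definition delzant_polytope :: "(real ^ 'n) set \<Rightarrow> bool"
  where "delzant_polytope \<Delta> \<longleftrightarrow> polytope \<Delta> \<and> \<Delta> \<noteq> {} \<and>
    (\<forall>p. p extreme_point_of \<Delta> \<longrightarrow>
      (\<exists>(e::'n \<Rightarrow> (real ^ 'n) set) (u::'n \<Rightarrow> real ^ 'n).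
        bij_betw e UNIV {E. E edge_of \<Delta> \<and> p \<in> E} \<and>
        (\<forall>i. primitive_vector (u i) \<and> (\<exists>t>0. e i = closed_segment p (p + t *\<^sub>R u i))) \<and>
        lattice_basis u))"

text \<open>The index type \<open>'d\<close> enumerates the facets, without repetition.\<close>

definition facet_presentation ::
    "(real ^ 'n) set \<Rightarrow> ('d::finite \<Rightarrow> real ^ 'n) \<Rightarrow> ('d \<Rightarrow> real) \<Rightarrow> bool"
  where "facet_presentation \<Delta> v lam \<longleftrightarrow>
    \<Delta> = {x. \<forall>i. x \<bullet> v i \<le> lam i} \<and>
    (\<forall>i. primitive_vector (v i)) \<and>
    bij_betw (\<lambda>i. \<Delta> \<inter> {x. x \<bullet> v i = lam i}) UNIV {F. F facet_of \<Delta>}"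


section \<open>Delzant's construction\<close>

definition proj_pi :: "('d::finite \<Rightarrow> real ^ 'n) \<Rightarrow> real ^ 'd \<Rightarrow> real ^ 'n"
  where "proj_pi v t = (\<Sum>i\<in>UNIV. (t $ i) *\<^sub>R v i)"

text \<open>Elements of the torus \<open>R^d/Z^d\<close> are written through representatives \<open>t\<close> in \<open>R^d\<close>;
  \<open>group_N v\<close> is the preimage in \<open>R^d\<close> of the kernel of the induced map of tori.\<close>

definition torus_act :: "real ^ 'd \<Rightarrow> complex ^ 'd \<Rightarrow> complex ^ 'd"
  where "torus_act t z = (\<chi> j. cis (2 * pi * t $ j) * z $ j)"

definition group_N :: "('d::finite \<Rightarrow> real ^ 'n) \<Rightarrow> (real ^ 'd) set"
  where "group_N v = {t. proj_pi v t \<in> int_lattice}"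

definition lie_N :: "('d::finite \<Rightarrow> real ^ 'n) \<Rightarrow> (real ^ 'd) set"
  where "lie_N v = {\<xi>. proj_pi v \<xi> = 0}"

definition orbit_N :: "('d::finite \<Rightarrow> real ^ 'n) \<Rightarrow> complex ^ 'd \<Rightarrow> (complex ^ 'd) set"
  where "orbit_N v z = (\<lambda>t. torus_act t z) ` group_N v"

definition moment_T :: "('d::finite \<Rightarrow> real) \<Rightarrow> complex ^ 'd \<Rightarrow> real ^ 'd"
  where "moment_T lam z = (\<chi> j. - (1/2) * (cmod (z $ j))\<^sup>2 + lam j)"

text \<open>The \<open>N\<close>-moment map \<open>moment_T lam z\<close> restricted to the Lie algebra \<open>lie_N v\<close>,
  hence \<open>level_Z\<close> is its zero set.\<close>

definition level_Z :: "('d::finite \<Rightarrow> real ^ 'n) \<Rightarrow> ('d \<Rightarrow> real) \<Rightarrow> (complex ^ 'd) set"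
  where "level_Z v lam = {z. \<forall>\<xi>\<in>lie_N v. moment_T lam z \<bullet> \<xi> = 0}"

definition toric_M :: "('d::finite \<Rightarrow> real ^ 'n) \<Rightarrow> ('d \<Rightarrow> real) \<Rightarrow> (complex ^ 'd) set set"
  where "toric_M v lam = orbit_N v ` level_Z v lam"

text \<open>Tangent space of the \<open>N\<close>-orbit, spanned by the fundamental vector fields.\<close>

definition vertical_space :: "('d::finite \<Rightarrow> real ^ 'n) \<Rightarrow> complex ^ 'd \<Rightarrow> (complex ^ 'd) set"
  where "vertical_space v z =
    {vector_derivative (\<lambda>t. torus_act (t *\<^sub>R \<xi>) z) (at 0) |\<xi>. \<xi> \<in> lie_N v}"

text \<open>The flat metric is the real inner product of \<open>complex ^ 'd\<close>.\<close>

definition horizontal_space ::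
    "('d::finite \<Rightarrow> real ^ 'n) \<Rightarrow> ('d \<Rightarrow> real) \<Rightarrow> complex ^ 'd \<Rightarrow> (complex ^ 'd) set"
  where "horizontal_space v lam z =
    {h \<in> tangent_space (level_Z v lam) z. \<forall>a\<in>vertical_space v z. h \<bullet> a = 0}"

text \<open>The quotient map has kernel \<open>vertical_space v z\<close> on tangent vectors at \<open>z\<close>, so the
  horizontal lift of the image of \<open>w\<close> is the horizontal vector differing from \<open>w\<close> by a
  vertical one.\<close>

definition horizontal_part ::
    "('d::finite \<Rightarrow> real ^ 'n) \<Rightarrow> ('d \<Rightarrow> real) \<Rightarrow> complex ^ 'd \<Rightarrow> complex ^ 'd \<Rightarrow> complex ^ 'd"
  where "horizontal_part v lam z w =
    (THE h. h \<in> horizontal_space v lam z \<and> w - h \<in> vertical_space v z)"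

text \<open>Local parametrizations of the quotient (inverses of smooth real charts), modelled on
  \<open>complex ^ 'n\<close> viewed as a real vector space of dimension \<open>2n\<close> and given with a smooth lift
  \<open>s\<close> to the level set.  The last two conditions say that \<open>x \<mapsto> orbit_N v (s x)\<close> is an
  injective immersion; as the quotient has real dimension \<open>2n\<close>, it is a diffeomorphism onto
  an open subset.  The quotient map being a submersion, such parametrizations exist around every
  point.\<close>

definition local_param ::
    "('d::finite \<Rightarrow> real ^ 'n) \<Rightarrow> ('d \<Rightarrow> real) \<Rightarrow> (complex ^ 'n) set
      \<Rightarrow> (complex ^ 'n \<Rightarrow> complex ^ 'd) \<Rightarrow> bool"
  where "local_param v lam U s \<longleftrightarrow>
    open U \<and> smooth_on U s \<and> s ` U \<subseteq> level_Z v lam \<and>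
    inj_on (\<lambda>x. orbit_N v (s x)) U \<and>
    (\<forall>x\<in>U. \<forall>u. dir_deriv s x u \<in> vertical_space v (s x) \<longrightarrow> u = 0)"

definition lift ::
    "('d::finite \<Rightarrow> real ^ 'n) \<Rightarrow> ('d \<Rightarrow> real) \<Rightarrow> (complex ^ 'n \<Rightarrow> complex ^ 'd)
      \<Rightarrow> complex ^ 'n \<Rightarrow> complex ^ 'n \<Rightarrow> complex ^ 'd"
  where "lift v lam s x u = horizontal_part v lam (s x) (dir_deriv s x u)"

text \<open>Coordinate expressions of the metric and complex structure of the quotient.\<close>

definition toric_metric ::
    "('d::finite \<Rightarrow> real ^ 'n) \<Rightarrow> ('d \<Rightarrow> real) \<Rightarrow> (complex ^ 'n \<Rightarrow> complex ^ 'd)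
      \<Rightarrow> complex ^ 'n \<Rightarrow> complex ^ 'n \<Rightarrow> complex ^ 'n \<Rightarrow> real"
  where "toric_metric v lam s x u w = lift v lam s x u \<bullet> lift v lam s x w"

definition toric_J ::
    "('d::finite \<Rightarrow> real ^ 'n) \<Rightarrow> ('d \<Rightarrow> real) \<Rightarrow> (complex ^ 'n \<Rightarrow> complex ^ 'd)
      \<Rightarrow> complex ^ 'n \<Rightarrow> complex ^ 'n \<Rightarrow> complex ^ 'n"
  where "toric_J v lam s x u = (THE w. lift v lam s x w = \<i> *s lift v lam s x u)"

end

theory Submission
  imports Defs
begin

text \<open>
  Write \<open>\<nn>\<close> for the Lie algebra \<open>lie_N v\<close>, let real vectors \<open>\<xi>\<close> act on \<open>C^d\<close> by multiplication of
  coordinates, \<open>\<xi> \<odot> z\<close>, and let \<open>s\<close> be a lift of a chart to the level set.  Vertical vectors at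
  \<open>s x\<close> are the \<open>i(\<xi> \<odot> s)\<close> and normal vectors of the level set are the \<open>\<xi> \<odot> s\<close>, with \<open>\<xi> \<in> \<nn>\<close>.
  The whole proof is the identity
    \<open>R(V, JV, JV, V) = 4 |\<beta> \<odot> s|^2\<close>
  where \<open>\<beta> \<in> \<nn>\<close> is determined by the horizontal lift \<open>h\<close> of \<open>V\<close> through
    \<open>\<langle>\<beta> \<odot> s, \<xi> \<odot> s\<rangle> = - (\<Sum>j. \<xi>_j |h_j|^2)\<close> for all \<open>\<xi> \<in> \<nn>\<close>.
  Three quarters of the right hand side are O'Neill's term and one quarter is the Gauss equation of the
  level set, whose second fundamental form on \<open>(h, h)\<close> is \<open>\<beta> \<odot> s\<close>; the mixed term vanishes because
  \<open>\<langle>\<xi> \<odot> h, ih\<rangle> = 0\<close>.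

  If the curvature vanished, then \<open>\<beta> \<odot> s = 0\<close>, so the vector \<open>(|h_j|^2)\<close> would be orthogonal to \<open>\<nn>\<close>,
  that is of the form \<open>(\<langle>y, v_j\<rangle>)\<close>.  Its entries being nonnegative, \<open>-y\<close> is a recession direction of
  the polytope, and boundedness forces \<open>y = 0\<close>, hence \<open>h = 0\<close> and \<open>V = 0\<close>
  (\<open>delzant_recession_trivial\<close>).

  Two facts make the objects well defined.  Multiplication \<open>\<xi> \<mapsto> \<xi> \<odot> z\<close> is injective on \<open>\<nn>\<close> for \<open>z\<close>
  in the level set (\<open>level_Z_free\<close>); this says that the normals of the facets through a point of the
  polytope are linearly independent, and it is where the Delzant condition at the vertices enters.
  And \<open>dim \<nn> \<ge> d - n\<close>, so that a chart with \<open>2n\<close> real coordinates exhausts the horizontal space, which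
  makes \<open>J\<close> and the Christoffel symbols exist.

  To compute curvature in a chart without the language of submersions, decompose
  \<open>ds(u) = L u + i(\<eta>(u) \<odot> s)\<close> into horizontal and vertical parts and use the covariant derivative
  \<open>\<nabla>_u W = D_u W - i(\<eta>(u) \<odot> W)\<close> on functions with values in \<open>C^d\<close>.  It is metric, \<open>\<nabla>_u s = L u\<close>, and
  its commutator is multiplication by the curvature of the connection form \<open>\<eta>\<close>.  In these terms the
  Levi-Civita connection is the horizontal part of \<open>\<nabla>_u (L w)\<close> (\<open>koszul\<close>, \<open>L_\<Gamma>\<close>), and differentiating
  this once more gives the Riemann tensor (\<open>riemann_formula\<close>).  The remaining analysis is
  the smoothness of \<open>\<eta>\<close> and of the Christoffel symbols; both solve linear systems with smooth
  coefficients (\<open>smooth_on_linear_solve\<close>).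
\<close>

section \<open>Calculus of smooth functions on open sets\<close>

lemma dir_deriv_at: "(f has_derivative f') (at x) \<Longrightarrow> dir_deriv f x u = f' u"
  by (metis frechet_derivative_at)

text \<open>If neither function is differentiable at \<open>x\<close>, the two derivatives are the same arbitrary
  choice, made from the same empty set of candidates.\<close>

lemma dir_deriv_cong:
  assumes "open U" "x \<in> U" "\<And>y. y \<in> U \<Longrightarrow> f y = g y"
  shows "dir_deriv f x u = dir_deriv g x u"
proof (cases "f differentiable at x")
  case True
  then show ?thesis
    using frechet_derivative_transform_within_open[of f x U g] assms by auto
next
  case False
  have "\<not> g differentiable at x"
    using False assms by (metis differentiable_def has_derivative_transform_within_open)
  with False have "\<And>D. (f has_derivative D) (at x) \<longleftrightarrow> (g has_derivative D) (at x)"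
    by (auto simp: differentiable_def)
  then show ?thesis by (simp add: frechet_derivative_def)
qed

lemma Ck_on_cong:
  assumes "open U" "\<And>y. y \<in> U \<Longrightarrow> f y = g y" "Ck_on k U f"
  shows "Ck_on k U g"
  using assms(2,3)
proof (induction k arbitrary: f g)
  case 0
  then show ?case by (metis Ck_on.simps(1) continuous_on_cong)
next
  case (Suc k)
  have "g differentiable at x" if "x \<in> U" for x
    using Suc.prems that assms(1) has_derivative_transform_within_open[of f _ x UNIV U g]
    by (fastforce simp: differentiable_def)
  moreover have "Ck_on k U (\<lambda>x. dir_deriv g x u)" for u
    using Suc.IH[of "\<lambda>x. dir_deriv f x u" "\<lambda>x. dir_deriv g x u"] Suc.prems
      dir_deriv_cong[OF assms(1), of _ f g] by auto
  ultimately show ?case by simp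
qed

lemma Ck_on_Suc_imp: "Ck_on (Suc k) U f \<Longrightarrow> Ck_on k U f"
proof (induction k arbitrary: f)
  case 0
  then show ?case
    by (auto intro!: continuous_at_imp_continuous_on differentiable_imp_continuous_within)
next
  case (Suc k)
  then show ?case by (metis Ck_on.simps(2))
qed

lemma Ck_on_const: "Ck_on k U (\<lambda>x. c)"
  by (induction k arbitrary: c) auto

lemma Ck_on_add:
  assumes "open U"
  shows "Ck_on k U f \<Longrightarrow> Ck_on k U g \<Longrightarrow> Ck_on k U (\<lambda>x. f x + g x)"
proof (induction k arbitrary: f g)
  case 0
  then show ?case by (auto intro: continuous_on_add)
next
  case (Suc k)
  have d: "dir_deriv (\<lambda>x. f x + g x) x u = dir_deriv f x u + dir_deriv g x u" if "x \<in> U" for x u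
    using Suc.prems that
    by (intro dir_deriv_at has_derivative_add) (auto simp: frechet_derivative_works)
  have "Ck_on k U (\<lambda>x. dir_deriv (\<lambda>x. f x + g x) x u)" for u
    by (rule Ck_on_cong[OF assms, of "\<lambda>x. dir_deriv f x u + dir_deriv g x u"])
       (use d Suc in auto)
  then show ?case using Suc.prems by auto
qed

lemma Ck_on_bilinear:
  assumes "bounded_bilinear m" "open U"
  shows "Ck_on k U f \<Longrightarrow> Ck_on k U g \<Longrightarrow> Ck_on k U (\<lambda>x. m (f x) (g x))"
proof (induction k arbitrary: f g)
  case 0
  then show ?case by (auto intro: bounded_bilinear.continuous_on[OF assms(1)])
next
  case (Suc k)
  have h: "((\<lambda>x. m (f x) (g x)) has_derivative (\<lambda>u. m (f x) (dir_deriv g x u) + m (dir_deriv f x u) (g x))) (at x)"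
    if "x \<in> U" for x
    using Suc.prems that by (intro bounded_bilinear.FDERIV[OF assms(1)]) (auto simp: frechet_derivative_works)
  have "Ck_on k U (\<lambda>x. dir_deriv (\<lambda>x. m (f x) (g x)) x u)" for u
  proof (rule Ck_on_cong[OF assms(2)])
    show "Ck_on k U (\<lambda>x. m (f x) (dir_deriv g x u) + m (dir_deriv f x u) (g x))"
      using Suc.prems Ck_on_Suc_imp[OF Suc.prems(1)] Ck_on_Suc_imp[OF Suc.prems(2)]
      by (intro Ck_on_add[OF assms(2)] Suc.IH) auto
  qed (use dir_deriv_at[OF h] in auto)
  moreover have "(\<lambda>x. m (f x) (g x)) differentiable at x" if "x \<in> U" for x
    using h[OF that] by (auto simp: differentiable_def)
  ultimately show ?case by simp
qed

lemma Ck_on_linear: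
  assumes "open U" "bounded_linear A"
  shows "Ck_on k U f \<Longrightarrow> Ck_on k U (\<lambda>x. A (f x))"
proof (induction k arbitrary: f)
  case 0
  then show ?case using assms by (auto intro: bounded_linear.continuous_on)
next
  case (Suc k)
  have h: "((\<lambda>x. A (f x)) has_derivative (\<lambda>u. A (dir_deriv f x u))) (at x)" if "x \<in> U" for x
    using Suc.prems that
    by (intro bounded_linear.has_derivative[OF assms(2)]) (auto simp: frechet_derivative_works)
  have "Ck_on k U (\<lambda>x. dir_deriv (\<lambda>x. A (f x)) x u)" for u
    by (rule Ck_on_cong[OF assms(1), of "\<lambda>x. A (dir_deriv f x u)"])
       (use dir_deriv_at[OF h] Suc in auto)
  moreover have "(\<lambda>x. A (f x)) differentiable at x" if "x \<in> U" for x
    using h[OF that] by (auto simp: differentiable_def)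
  ultimately show ?case by simp
qed

lemma Ck_on_sum:
  assumes "open U" "\<And>i. i \<in> I \<Longrightarrow> Ck_on k U (f i)"
  shows "Ck_on k U (\<lambda>x. \<Sum>i\<in>I. f i x)"
  using assms(2)
  by (induction I rule: infinite_finite_induct) (auto intro: Ck_on_const Ck_on_add[OF assms(1)])

lemma smooth_onD: "smooth_on U f \<Longrightarrow> Ck_on k U f"
  by (simp add: smooth_on_def)

lemma smooth_on_has_derivative:
  "smooth_on U f \<Longrightarrow> x \<in> U \<Longrightarrow> (f has_derivative (\<lambda>u. dir_deriv f x u)) (at x)"
  using smooth_onD[of U f "Suc 0"] by (auto simp: frechet_derivative_works)

lemma smooth_on_dir_deriv: "smooth_on U f \<Longrightarrow> smooth_on U (\<lambda>x. dir_deriv f x u)"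
  unfolding smooth_on_def by (metis Ck_on.simps(2))

lemma smooth_on_cong:
  "open U \<Longrightarrow> smooth_on U f \<Longrightarrow> (\<And>y. y \<in> U \<Longrightarrow> f y = g y) \<Longrightarrow> smooth_on U g"
  unfolding smooth_on_def using Ck_on_cong by blast

lemma smooth_on_const: "smooth_on U (\<lambda>x. c)"
  by (simp add: smooth_on_def Ck_on_const)

lemma smooth_on_add:
  "open U \<Longrightarrow> smooth_on U f \<Longrightarrow> smooth_on U g \<Longrightarrow> smooth_on U (\<lambda>x. f x + g x)"
  by (simp add: smooth_on_def Ck_on_add)

lemma smooth_on_linear:
  "open U \<Longrightarrow> bounded_linear A \<Longrightarrow> smooth_on U f \<Longrightarrow> smooth_on U (\<lambda>x. A (f x))"
  by (simp add: smooth_on_def Ck_on_linear)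

lemma smooth_on_diff:
  "open U \<Longrightarrow> smooth_on U f \<Longrightarrow> smooth_on U g \<Longrightarrow> smooth_on U (\<lambda>x. f x - g x)"
  using smooth_on_add[of U f "\<lambda>x. - g x"]
    smooth_on_linear[of U "\<lambda>x. - x" g, OF _ bounded_linear_minus[OF bounded_linear_ident]]
  by simp

lemma smooth_on_bilinear:
  "bounded_bilinear m \<Longrightarrow> open U \<Longrightarrow> smooth_on U f \<Longrightarrow> smooth_on U g \<Longrightarrow> smooth_on U (\<lambda>x. m (f x) (g x))"
  by (simp add: smooth_on_def Ck_on_bilinear)

lemma smooth_on_sum:
  "open U \<Longrightarrow> (\<And>i. i \<in> I \<Longrightarrow> smooth_on U (f i)) \<Longrightarrow> smooth_on U (\<lambda>x. \<Sum>i\<in>I. f i x)"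
  by (simp add: smooth_on_def Ck_on_sum)

text \<open>The product rule needs differentiability of \<open>p\<close> only where \<open>q\<close> does not vanish: near \<open>x\<close>
  the factor \<open>q\<close> is of first order, so \<open>(p y - p x) q y\<close> is of higher order as soon as \<open>p\<close> is
  continuous.\<close>

lemma has_derivative_scaleR_vanishing:
  fixes p :: "'a::real_normed_vector \<Rightarrow> real" and q :: "'a \<Rightarrow> 'b::real_normed_vector"
  assumes p: "isCont p x" and q: "(q has_derivative q') (at x)" and q0: "q x = 0"
  shows "((\<lambda>y. p y *\<^sub>R q y) has_derivative (\<lambda>u. p x *\<^sub>R q' u)) (at x)"
proof -
  have bl: "bounded_linear q'" using q by (rule has_derivative_bounded_linear)
  then obtain K where K: "\<And>u. norm (q' u) \<le> norm u * K" "K > 0"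
    using bounded_linear.pos_bounded by blast
  have lim: "((\<lambda>y. norm (q y - q x - q' (y - x)) / norm (y - x)) \<longlongrightarrow> 0) (at x)"
    using q by (simp add: has_derivative_iff_norm)
  have plim: "((\<lambda>y. \<bar>p y - p x\<bar>) \<longlongrightarrow> 0) (at x)"
    using p unfolding isCont_def using LIM_zero tendsto_rabs_zero by blast
  have "((\<lambda>y. (p y - p x) *\<^sub>R q y) has_derivative (\<lambda>u. 0)) (at x)"
    unfolding has_derivative_iff_norm
  proof (intro conjI)
    have "((\<lambda>y. \<bar>p y - p x\<bar> * (norm (q y - q x - q' (y - x)) / norm (y - x) + K)) \<longlongrightarrow> 0 * (0 + K)) (at x)"
      by (intro tendsto_intros plim lim)
    then have b: "((\<lambda>y. \<bar>p y - p x\<bar> * (norm (q y - q x - q' (y - x)) / norm (y - x) + K)) \<longlongrightarrow> 0) (at x)"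
      by simp
    show "((\<lambda>y. norm ((p y - p x) *\<^sub>R q y - (p x - p x) *\<^sub>R q x - 0) / norm (y - x)) \<longlongrightarrow> 0) (at x)"
    proof (rule tendsto_sandwich[OF _ _ tendsto_const b])
      show "\<forall>\<^sub>F y in at x. norm ((p y - p x) *\<^sub>R q y - (p x - p x) *\<^sub>R q x - 0) / norm (y - x)
          \<le> \<bar>p y - p x\<bar> * (norm (q y - q x - q' (y - x)) / norm (y - x) + K)"
      proof (rule eventually_mono[OF eventually_at_filter[THEN iffD2, OF always_eventually]])
        show "\<forall>y. y \<noteq> x \<longrightarrow> y \<in> UNIV \<longrightarrow> y \<noteq> x" by simp
        fix y assume y: "y \<noteq> x"
        have "norm (q y) \<le> norm (q y - q x - q' (y - x)) + norm (q' (y - x))"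
          using q0 norm_triangle_sub[of "q y" "q' (y - x)"] by simp
        also have "\<dots> \<le> norm (q y - q x - q' (y - x)) + norm (y - x) * K"
          using K by simp
        finally have "norm (q y) / norm (y - x) \<le> norm (q y - q x - q' (y - x)) / norm (y - x) + K"
          using y by (simp add: field_simps)
        then show "norm ((p y - p x) *\<^sub>R q y - (p x - p x) *\<^sub>R q x - 0) / norm (y - x)
          \<le> \<bar>p y - p x\<bar> * (norm (q y - q x - q' (y - x)) / norm (y - x) + K)"
          using mult_left_mono[of _ _ "\<bar>p y - p x\<bar>"] by fastforce
      qed
    qed auto
  qed simp
  moreover have "((\<lambda>y. p x *\<^sub>R q y) has_derivative (\<lambda>u. p x *\<^sub>R q' u)) (at x)"
    using q by (rule has_derivative_scaleR_right)
  ultimately have "((\<lambda>y. (p y - p x) *\<^sub>R q y + p x *\<^sub>R q y) has_derivative (\<lambda>u. 0 + p x *\<^sub>R q' u)) (at x)"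
    by (rule has_derivative_add)
  then show ?thesis by (simp add: scaleR_left_diff_distrib)
qed

lemma linear_basis_expansion:
  fixes t :: "'e::euclidean_space"
  assumes "linear A"
  shows "A t = (\<Sum>b\<in>Basis. (t \<bullet> b) *\<^sub>R A b)"
proof -
  have "A t = A (\<Sum>b\<in>Basis. (t \<bullet> b) *\<^sub>R b)" by (simp add: euclidean_representation)
  also have "\<dots> = (\<Sum>b\<in>Basis. (t \<bullet> b) *\<^sub>R A b)"
    using assms by (simp add: linear_sum linear_scale)
  finally show ?thesis .
qed

text \<open>The next three lemmas show that a solution \<open>c\<close> of the linear systems \<open>B y (c y) = f y\<close> is
  as regular as the data. Injectivity suffices, so systems with more equations than unknowns
  are covered. Here the lower bound \<open>m |t| \<le> |B x t|\<close> survives small perturbations of \<open>B x\<close>.\<close>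

lemma isCont_linear_solve:
  fixes B :: "'a::real_normed_vector \<Rightarrow> 'e::euclidean_space \<Rightarrow> 'g::euclidean_space"
  assumes U: "open U" "x \<in> U" and lin: "\<And>y. y \<in> U \<Longrightarrow> linear (B y)" and inj: "inj (B x)"
    and B: "\<And>t. isCont (\<lambda>y. B y t) x" and f: "isCont f x"
    and eq: "\<And>y. y \<in> U \<Longrightarrow> B y (c y) = f y"
  shows "isCont c x"
proof -
  obtain m where m: "m > 0" "\<And>t. m * norm t \<le> norm (B x t)"
    using linear_inj_bounded_below_pos[OF lin[OF U(2)] inj] by metis
  define \<beta> where "\<beta> y = (\<Sum>b\<in>Basis. norm (B y b - B x b))" for y
  have \<beta>lim: "(\<beta> \<longlongrightarrow> 0) (at x)"
    unfolding \<beta>_def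
    by (rule tendsto_null_sum, rule tendsto_norm_zero, rule LIM_zero)
       (use B in \<open>simp add: isCont_def\<close>)
  have \<beta>: "norm (B y t - B x t) \<le> \<beta> y * norm t" if "y \<in> U" for y t
  proof -
    have "B y t - B x t = (\<Sum>b\<in>Basis. (t \<bullet> b) *\<^sub>R (B y b - B x b))"
      using linear_basis_expansion[OF lin[OF that], of t] linear_basis_expansion[OF lin[OF U(2)], of t]
      by (simp add: scaleR_diff_right sum_subtractf)
    also have "norm \<dots> \<le> (\<Sum>b\<in>Basis. norm t * norm (B y b - B x b))"
      by (rule order.trans[OF norm_sum], rule sum_mono)
         (auto intro: mult_right_mono Basis_le_norm)
    finally show ?thesis by (simp add: \<beta>_def sum_distrib_left mult.commute)
  qed
  have flim: "((\<lambda>y. norm (f y - f x)) \<longlongrightarrow> 0) (at x)"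
    using f unfolding isCont_def using LIM_zero tendsto_norm_zero by blast
  have "((\<lambda>y. 2 / m * (norm (f y - f x) + \<beta> y * norm (c x))) \<longlongrightarrow> 2 / m * (0 + 0 * norm (c x))) (at x)"
    by (intro tendsto_intros flim \<beta>lim)
  then have lim: "((\<lambda>y. 2 / m * (norm (f y - f x) + \<beta> y * norm (c x))) \<longlongrightarrow> 0) (at x)"
    by simp
  have ev: "\<forall>\<^sub>F y in at x. y \<in> U \<and> \<beta> y < m / 2"
    using eventually_at_in_open'[OF U] order_tendstoD(2)[OF \<beta>lim, of "m/2"] m
    by (auto intro: eventually_conj)
  have "((\<lambda>y. c y - c x) \<longlongrightarrow> 0) (at x)"
  proof (rule Lim_null_comparison[OF _ lim], rule eventually_mono[OF ev])
    fix y assume y: "y \<in> U \<and> \<beta> y < m / 2"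
    have "B x (c y - c x) = f y - f x - (B y (c y) - B x (c y))"
      using eq[of y] eq[of x] y U lin[of x] by (simp add: linear_diff)
    then have "m * norm (c y - c x) \<le> norm (f y - f x - (B y (c y) - B x (c y)))"
      using m(2) by metis
    also have "\<dots> \<le> norm (f y - f x) + norm (B y (c y) - B x (c y))"
      by (rule norm_triangle_ineq4)
    also have "\<dots> \<le> norm (f y - f x) + \<beta> y * (norm (c y - c x) + norm (c x))"
    proof -
      have "\<beta> y * norm (c y) \<le> \<beta> y * (norm (c y - c x) + norm (c x))"
        by (rule mult_left_mono) (auto simp: \<beta>_def sum_nonneg norm_triangle_sub add.commute)
      then show ?thesis using \<beta>[of y "c y"] y by auto
    qed
    also have "\<dots> \<le> norm (f y - f x) + m / 2 * norm (c y - c x) + \<beta> y * norm (c x)"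
      using y mult_right_mono[of "\<beta> y" "m/2" "norm (c y - c x)"] by (simp add: algebra_simps)
    finally show "norm (c y - c x) \<le> 2 / m * (norm (f y - f x) + \<beta> y * norm (c x))"
      using m by (simp add: field_simps)
  qed
  then show ?thesis by (simp add: isCont_def LIM_zero_iff)
qed

text \<open>Apply a left inverse of \<open>B x\<close> to \<open>B x (c y) = f y - (B y - B x) (c y)\<close>: the correction
  vanishes at \<open>y = x\<close>, so continuity of \<open>c\<close> is enough to differentiate it.\<close>

lemma differentiable_linear_solve:
  fixes B :: "'a::real_normed_vector \<Rightarrow> 'e::euclidean_space \<Rightarrow> 'g::euclidean_space"
  assumes U: "open U" "x \<in> U" and lin: "\<And>y. y \<in> U \<Longrightarrow> linear (B y)" and inj: "inj (B x)"
    and B: "\<And>t. (\<lambda>y. B y t) differentiable at x" and f: "f differentiable at x"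
    and eq: "\<And>y. y \<in> U \<Longrightarrow> B y (c y) = f y"
  shows "c differentiable at x"
    and "B x (dir_deriv c x u) =
      dir_deriv f x u - (\<Sum>b\<in>Basis. (c x \<bullet> b) *\<^sub>R dir_deriv (\<lambda>y. B y b) x u)"
proof -
  have cc: "isCont c x"
    by (rule isCont_linear_solve[where B = B and f = f and U = U])
       (use assms in \<open>auto intro!: differentiable_imp_continuous_within\<close>)
  have Bd: "((\<lambda>y. B y b) has_derivative dir_deriv (\<lambda>y. B y b) x) (at x)" for b
    using B[of b] by (auto simp: frechet_derivative_works)
  have fd: "(f has_derivative dir_deriv f x) (at x)"
    using f by (auto simp: frechet_derivative_works)
  obtain A where A: "linear A" "A \<circ> B x = id"
    using linear_injective_left_inverse[OF lin[OF U(2)] inj] by metis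
  have Abl: "bounded_linear A" using A(1) by (rule linear_conv_bounded_linear[THEN iffD1])
  have "((\<lambda>y. (c y \<bullet> b) *\<^sub>R (B y b - B x b)) has_derivative (\<lambda>u. (c x \<bullet> b) *\<^sub>R dir_deriv (\<lambda>y. B y b) x u)) (at x)"
    for b
    by (rule has_derivative_scaleR_vanishing)
       (use cc Bd in \<open>auto intro!: continuous_intros derivative_eq_intros\<close>)
  then have S: "((\<lambda>y. \<Sum>b\<in>Basis. (c y \<bullet> b) *\<^sub>R (B y b - B x b)) has_derivative
      (\<lambda>u. \<Sum>b\<in>Basis. (c x \<bullet> b) *\<^sub>R dir_deriv (\<lambda>y. B y b) x u)) (at x)"
    by (intro has_derivative_sum)
  let ?F = "\<lambda>y. A (f y - (\<Sum>b\<in>Basis. (c y \<bullet> b) *\<^sub>R (B y b - B x b)))"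
  have F: "(?F has_derivative (\<lambda>u. A (dir_deriv f x u - (\<Sum>b\<in>Basis. (c x \<bullet> b) *\<^sub>R dir_deriv (\<lambda>y. B y b) x u)))) (at x)"
    by (intro bounded_linear.has_derivative[OF Abl] has_derivative_diff fd S)
  have "?F y = c y" if "y \<in> U" for y
  proof -
    have "(\<Sum>b\<in>Basis. (c y \<bullet> b) *\<^sub>R (B y b - B x b)) = B y (c y) - B x (c y)"
      using linear_basis_expansion[OF lin[OF that], of "c y"] linear_basis_expansion[OF lin[OF U(2)], of "c y"]
      by (simp add: scaleR_diff_right sum_subtractf)
    then show ?thesis using eq[OF that] A(2) by (simp add: fun_eq_iff)
  qed
  then have cd: "(c has_derivative (\<lambda>u. A (dir_deriv f x u - (\<Sum>b\<in>Basis. (c x \<bullet> b) *\<^sub>R dir_deriv (\<lambda>y. B y b) x u)))) (at x)"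
    using has_derivative_transform_within_open[OF F U] by blast
  then show "c differentiable at x" by (auto simp: differentiable_def)
  then have cw: "(c has_derivative dir_deriv c x) (at x)" by (auto simp: frechet_derivative_works)
  have E: "((\<lambda>y. \<Sum>b\<in>Basis. (c y \<bullet> b) *\<^sub>R B y b) has_derivative
      (\<lambda>u. \<Sum>b\<in>Basis. ((c x \<bullet> b) *\<^sub>R dir_deriv (\<lambda>y. B y b) x u + (dir_deriv c x u \<bullet> b) *\<^sub>R B x b))) (at x)"
    by (intro has_derivative_sum has_derivative_scaleR has_derivative_inner_left cw Bd)
  have "(\<Sum>b\<in>Basis. (c y \<bullet> b) *\<^sub>R B y b) = f y" if "y \<in> U" for y
    using linear_basis_expansion[OF lin[OF that], of "c y"] eq[OF that] by simp
  then have "dir_deriv f x u = (\<Sum>b\<in>Basis. ((c x \<bullet> b) *\<^sub>R dir_deriv (\<lambda>y. B y b) x u + (dir_deriv c x u \<bullet> b) *\<^sub>R B x b))"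
    using dir_deriv_at[OF has_derivative_transform_within_open[OF E U]] by blast
  also have "\<dots> = (\<Sum>b\<in>Basis. (c x \<bullet> b) *\<^sub>R dir_deriv (\<lambda>y. B y b) x u) + B x (dir_deriv c x u)"
    by (simp add: sum.distrib linear_basis_expansion[OF lin[OF U(2)], of "dir_deriv c x u"])
  finally show "B x (dir_deriv c x u) =
      dir_deriv f x u - (\<Sum>b\<in>Basis. (c x \<bullet> b) *\<^sub>R dir_deriv (\<lambda>y. B y b) x u)"
    by simp
qed

text \<open>The directional derivative of \<open>c\<close> solves a system with the same \<open>B\<close> and a right hand side
  containing only \<open>c\<close> and derivatives of the data, so regularity improves by one order at a
  time.\<close>

lemma smooth_on_linear_solve:
  fixes B :: "'a::real_normed_vector \<Rightarrow> 'e::euclidean_space \<Rightarrow> 'g::euclidean_space"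
  assumes U: "open U" and lin: "\<And>y. y \<in> U \<Longrightarrow> linear (B y)" and inj: "\<And>y. y \<in> U \<Longrightarrow> inj (B y)"
    and B: "\<And>t. smooth_on U (\<lambda>y. B y t)" and f: "smooth_on U f"
    and eq: "\<And>y. y \<in> U \<Longrightarrow> B y (c y) = f y"
  shows "smooth_on U c"
proof -
  have "Ck_on k U c" if "Ck_on k U f" "\<And>y. y \<in> U \<Longrightarrow> B y (c y) = f y" for k c f
    using that
  proof (induction k arbitrary: c f)
    case 0
    have "isCont c x" if "x \<in> U" for x
      by (rule isCont_linear_solve[where B = B and f = f and U = U])
         (use 0 lin inj smooth_onD[OF B, of 0] U that in \<open>auto simp: continuous_on_eq_continuous_at\<close>)
    then show ?case by (auto intro: continuous_at_imp_continuous_on)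
  next
    case (Suc k)
    have Bd: "(\<lambda>y. B y t) differentiable at x" if "x \<in> U" for x t
      using smooth_onD[OF B, of "Suc 0"] that by auto
    have fd: "f differentiable at x" if "x \<in> U" for x using Suc.prems that by auto
    note D = differentiable_linear_solve[where B = B and c = c and f = f and U = U]
    have "Ck_on k U c"
      using Suc.IH Suc.prems Ck_on_Suc_imp by blast
    then have "Ck_on k U (\<lambda>x. \<Sum>b\<in>Basis. (c x \<bullet> b) *\<^sub>R dir_deriv (\<lambda>y. B y b) x u)" for u
      using smooth_onD[OF smooth_on_dir_deriv[OF B]]
      by (intro Ck_on_sum[OF U] Ck_on_bilinear[OF bounded_bilinear_scaleR U]
          Ck_on_bilinear[OF bounded_bilinear_inner U] Ck_on_const)
    then have "Ck_on k U (\<lambda>x. dir_deriv f x u + (- (\<Sum>b\<in>Basis. (c x \<bullet> b) *\<^sub>R dir_deriv (\<lambda>y. B y b) x u)))" for u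
      using Suc.prems
      by (intro Ck_on_add[OF U] Ck_on_linear[OF U bounded_linear_minus[OF bounded_linear_ident]]) auto
    then have "Ck_on k U (\<lambda>x. dir_deriv c x u)" for u
      by (rule Suc.IH) (use D(2) U lin inj Bd fd Suc.prems(2) in simp)
    then show ?case using D(1) U lin inj Bd fd Suc.prems(2) by simp
  qed
  then show ?thesis using f eq unfolding smooth_on_def by blast
qed

text \<open>The mean value theorem, first in direction \<open>u\<close> and then in direction \<open>v\<close>.\<close>

lemma second_difference_mean_value:
  fixes f :: "'a::real_normed_vector \<Rightarrow> real"
  assumes "t > 0"
    and S: "\<And>a b. 0 \<le> a \<Longrightarrow> a \<le> t \<Longrightarrow> 0 \<le> b \<Longrightarrow> b \<le> t \<Longrightarrow> x + a *\<^sub>R u + b *\<^sub>R v \<in> U"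
    and f: "\<And>y. y \<in> U \<Longrightarrow> f differentiable at y"
    and fu: "\<And>y. y \<in> U \<Longrightarrow> (\<lambda>y. dir_deriv f y u) differentiable at y"
  shows "\<exists>a b. 0 \<le> a \<and> a \<le> t \<and> 0 \<le> b \<and> b \<le> t \<and>
    f (x + t *\<^sub>R u + t *\<^sub>R v) - f (x + t *\<^sub>R u) - f (x + t *\<^sub>R v) + f x
      = t^2 * dir_deriv (\<lambda>y. dir_deriv f y u) (x + a *\<^sub>R u + b *\<^sub>R v) v"
proof -
  let ?h = "\<lambda>a. f (x + a *\<^sub>R u + t *\<^sub>R v) - f (x + a *\<^sub>R u)"
  have dv: "((\<lambda>a. g (z + a *\<^sub>R w)) has_real_derivative dir_deriv g (z + a *\<^sub>R w) w) (at a)"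
    if "g differentiable at (z + a *\<^sub>R w)" for g :: "'a \<Rightarrow> real" and z w a
  proof -
    have g: "(g has_derivative dir_deriv g (z + a *\<^sub>R w)) (at (z + a *\<^sub>R w))"
      using that by (auto simp: frechet_derivative_works)
    have "((\<lambda>a. z + a *\<^sub>R w) has_derivative (\<lambda>h. h *\<^sub>R w)) (at a)"
      by (auto intro!: derivative_eq_intros)
    from has_derivative_compose[OF this g]
    have "((\<lambda>a. g (z + a *\<^sub>R w)) has_derivative (\<lambda>h. dir_deriv g (z + a *\<^sub>R w) (h *\<^sub>R w))) (at a)" .
    then show ?thesis
      using linear_scale[OF has_derivative_linear[OF g], of _ w]
      by (simp add: has_field_derivative_def mult_commute_abs)
  qed
  have "\<exists>a. 0 < a \<and> a < t \<and> ?h t - ?h 0 = (t - 0) * (dir_deriv f (x + a *\<^sub>R u + t *\<^sub>R v) u - dir_deriv f (x + a *\<^sub>R u) u)"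
  proof (rule MVT2[OF \<open>t > 0\<close>])
    fix a assume a: "0 \<le> a" "a \<le> t"
    have 1: "((\<lambda>a. f ((x + t *\<^sub>R v) + a *\<^sub>R u)) has_real_derivative dir_deriv f ((x + t *\<^sub>R v) + a *\<^sub>R u) u) (at a)"
      by (rule dv) (use S[of a t] f a \<open>t > 0\<close> in \<open>simp add: algebra_simps\<close>)
    have 2: "((\<lambda>a. f (x + a *\<^sub>R u)) has_real_derivative dir_deriv f (x + a *\<^sub>R u) u) (at a)"
      by (rule dv) (use S[of a 0] f a \<open>t > 0\<close> in simp)
    show "DERIV ?h a :> dir_deriv f (x + a *\<^sub>R u + t *\<^sub>R v) u - dir_deriv f (x + a *\<^sub>R u) u"
      using DERIV_diff[OF 1 2] by (simp add: algebra_simps)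
  qed
  then obtain a where a: "0 < a" "a < t"
    "?h t - ?h 0 = t * (dir_deriv f (x + a *\<^sub>R u + t *\<^sub>R v) u - dir_deriv f (x + a *\<^sub>R u) u)" by auto
  let ?k = "\<lambda>b. dir_deriv f (x + a *\<^sub>R u + b *\<^sub>R v) u"
  have "\<exists>b. 0 < b \<and> b < t \<and> ?k t - ?k 0 = (t - 0) * dir_deriv (\<lambda>y. dir_deriv f y u) (x + a *\<^sub>R u + b *\<^sub>R v) v"
    by (rule MVT2[OF \<open>t > 0\<close>], rule dv) (use S fu a in auto)
  then obtain b where b: "0 < b" "b < t" "?k t - ?k 0 = t * dir_deriv (\<lambda>y. dir_deriv f y u) (x + a *\<^sub>R u + b *\<^sub>R v) v"
    by auto
  have "f (x + t *\<^sub>R u + t *\<^sub>R v) - f (x + t *\<^sub>R u) - f (x + t *\<^sub>R v) + f x = ?h t - ?h 0" by simp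
  also have "\<dots> = t * (?k t - ?k 0)" using a by simp
  also have "\<dots> = t^2 * dir_deriv (\<lambda>y. dir_deriv f y u) (x + a *\<^sub>R u + b *\<^sub>R v) v"
    using b by (simp add: power2_eq_square)
  finally show ?thesis using a b by (metis less_imp_le)
qed

text \<open>The second difference of \<open>f\<close> over the parallelogram spanned by \<open>t u\<close> and \<open>t v\<close> is
  symmetric in \<open>u\<close> and \<open>v\<close>, and \<open>t^2\<close> times either mixed derivative at a nearby point.\<close>

lemma dir_deriv_commute_real:
  fixes f :: "'a::real_normed_vector \<Rightarrow> real"
  assumes U: "open U" "x \<in> U" and f: "smooth_on U f"
  shows "dir_deriv (\<lambda>y. dir_deriv f y u) x v = dir_deriv (\<lambda>y. dir_deriv f y v) x u"
proof -
  let ?G = "\<lambda>u v y. dir_deriv (\<lambda>y. dir_deriv f y u) y v"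
  have cont: "isCont (?G u v) x" for u v
    using smooth_onD[OF smooth_on_dir_deriv[OF smooth_on_dir_deriv[OF f]], of 0] U
    by (auto simp: continuous_on_eq_continuous_at)
  have df: "f differentiable at y" "(\<lambda>y. dir_deriv f y u) differentiable at y" if "y \<in> U" for y u
    using smooth_onD[OF f, of "Suc (Suc 0)"] that by auto
  have "\<bar>?G u v x - ?G v u x\<bar> \<le> e" if "e > 0" for e
  proof -
    obtain d1 where d1: "d1 > 0" "\<And>y. dist y x < d1 \<Longrightarrow> dist (?G u v y) (?G u v x) < e / 2"
      using cont[of u v] \<open>e > 0\<close> unfolding continuous_at_eps_delta by (metis half_gt_zero)
    obtain d2 where d2: "d2 > 0" "\<And>y. dist y x < d2 \<Longrightarrow> dist (?G v u y) (?G v u x) < e / 2"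
      using cont[of v u] \<open>e > 0\<close> unfolding continuous_at_eps_delta by (metis half_gt_zero)
    obtain d3 where d3: "d3 > 0" "\<And>y. dist y x < d3 \<Longrightarrow> y \<in> U"
      using U by (meson open_dist)
    define d where "d = min d1 (min d2 d3)"
    \<comment> \<open>Small enough for the parallelogram with sides \<open>t u\<close>, \<open>t v\<close> to lie in the ball of radius \<open>d\<close>.\<close>
    define t where "t = d / (2 * (norm u + norm v + 1))"
    have d: "d > 0" using d1 d2 d3 by (simp add: d_def)
    have pos: "norm u + norm v + 1 > 0" by (simp add: add_nonneg_pos)
    then have t: "t > 0" using d by (simp add: t_def)
    have near: "dist (x + a *\<^sub>R u + b *\<^sub>R v) x < d" if "0 \<le> a" "a \<le> t" "0 \<le> b" "b \<le> t" for a b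
    proof -
      have "dist (x + a *\<^sub>R u + b *\<^sub>R v) x \<le> a * norm u + b * norm v"
        using norm_triangle_ineq[of "a *\<^sub>R u" "b *\<^sub>R v"] that by (simp add: dist_norm)
      also have "\<dots> \<le> t * norm u + t * norm v"
        using that by (intro add_mono mult_right_mono) auto
      also have "\<dots> < t * (2 * (norm u + norm v + 1))"
        using t by (simp add: algebra_simps add_strict_increasing2 add_nonneg_pos)
      also have "\<dots> = d" using pos by (simp add: t_def)
      finally show ?thesis .
    qed
    have swap: "x + a *\<^sub>R u + b *\<^sub>R v = x + b *\<^sub>R v + a *\<^sub>R u" for a b by simp
    obtain a b where ab: "0 \<le> a" "a \<le> t" "0 \<le> b" "b \<le> t"
      "f (x + t *\<^sub>R u + t *\<^sub>R v) - f (x + t *\<^sub>R u) - f (x + t *\<^sub>R v) + f x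
      = t^2 * ?G u v (x + a *\<^sub>R u + b *\<^sub>R v)"
      using second_difference_mean_value[OF t, of x u v U f] near d3 df by (auto simp: d_def)
    obtain a' b' where ab': "0 \<le> a'" "a' \<le> t" "0 \<le> b'" "b' \<le> t"
      "f (x + t *\<^sub>R v + t *\<^sub>R u) - f (x + t *\<^sub>R v) - f (x + t *\<^sub>R u) + f x
      = t^2 * ?G v u (x + a' *\<^sub>R v + b' *\<^sub>R u)"
      using second_difference_mean_value[OF t, of x v u U f] near d3 df swap by (auto simp: d_def)
    have "t^2 * ?G u v (x + a *\<^sub>R u + b *\<^sub>R v) = t^2 * ?G v u (x + a' *\<^sub>R v + b' *\<^sub>R u)"
      using ab(5)[unfolded swap[of t t]] ab'(5) by linarith
    then have "?G u v (x + a *\<^sub>R u + b *\<^sub>R v) = ?G v u (x + a' *\<^sub>R v + b' *\<^sub>R u)"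
      using t by simp
    moreover have "dist (?G u v (x + a *\<^sub>R u + b *\<^sub>R v)) (?G u v x) < e / 2"
      using d1 near[OF ab(1-4)] by (simp add: d_def)
    moreover have "dist (?G v u (x + a' *\<^sub>R v + b' *\<^sub>R u)) (?G v u x) < e / 2"
      using d2 near[OF ab'(3,4,1,2)] swap[of b' a'] by (simp add: d_def)
    ultimately show ?thesis unfolding dist_real_def by linarith
  qed
  then have "\<bar>?G u v x - ?G v u x\<bar> \<le> 0" by (rule field_le_epsilon[of _ 0, simplified])
  then show ?thesis by simp
qed

lemma dir_deriv_inner_const:
  assumes "f differentiable at x"
  shows "dir_deriv (\<lambda>y. f y \<bullet> c) x u = dir_deriv f x u \<bullet> c"
  using assms by (intro dir_deriv_at has_derivative_inner_left) (auto simp: frechet_derivative_works)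

lemma dir_deriv_commute:
  fixes f :: "'a::real_normed_vector \<Rightarrow> 'b::euclidean_space"
  assumes U: "open U" "x \<in> U" and f: "smooth_on U f"
  shows "dir_deriv (\<lambda>y. dir_deriv f y u) x v = dir_deriv (\<lambda>y. dir_deriv f y v) x u"
proof (rule euclidean_eqI)
  fix b :: 'b assume "b \<in> Basis"
  have df: "f differentiable at y" "(\<lambda>y. dir_deriv f y u) differentiable at y" if "y \<in> U" for y u
    using smooth_onD[OF f, of "Suc (Suc 0)"] that by auto
  have *: "dir_deriv (\<lambda>y. dir_deriv f y u) x v \<bullet> b = dir_deriv (\<lambda>y. dir_deriv (\<lambda>y. f y \<bullet> b) y u) x v" for u v
    using dir_deriv_inner_const[OF df(2)[OF U(2)], of u b v]
      dir_deriv_cong[OF U, of "\<lambda>y. dir_deriv (\<lambda>y. f y \<bullet> b) y u" "\<lambda>y. dir_deriv f y u \<bullet> b" v]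
      dir_deriv_inner_const[OF df(1)] by simp
  show "dir_deriv (\<lambda>y. dir_deriv f y u) x v \<bullet> b = dir_deriv (\<lambda>y. dir_deriv f y v) x u \<bullet> b"
    unfolding * by (intro dir_deriv_commute_real[OF U] smooth_on_linear[OF U(1) bounded_linear_inner_left f])
qed

section \<open>Simplicity and boundedness of a Delzant polytope\<close>

lemma tight_face:
  fixes v :: "'d::finite \<Rightarrow> 'a::euclidean_space"
  assumes "\<Delta> = {x. \<forall>i. x \<bullet> v i \<le> lam i}"
  shows "{x \<in> \<Delta>. \<forall>j\<in>A. x \<bullet> v j = lam j} face_of \<Delta>" (is "?F face_of \<Delta>")
  unfolding face_of_def
proof (intro conjI ballI impI)
  show "?F \<subseteq> \<Delta>" by blast
  have "?F = (\<Inter>i. {x. v i \<bullet> x \<le> lam i}) \<inter> (\<Inter>j\<in>A. {x. v j \<bullet> x = lam j})"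
    using assms by (auto simp: inner_commute)
  then show "convex ?F"
    by (simp add: convex_Int convex_INT convex_halfspace_le convex_hyperplane)
  have tight: "a \<in> \<Delta> \<Longrightarrow> b \<in> \<Delta> \<Longrightarrow> x \<in> ?F \<Longrightarrow> x \<in> open_segment a b \<Longrightarrow> a \<in> ?F" for a b x
  proof -
    assume *: "a \<in> \<Delta>" "b \<in> \<Delta>" "x \<in> ?F" "x \<in> open_segment a b"
    obtain t where t: "0 < t" "t < 1" "x = (1 - t) *\<^sub>R a + t *\<^sub>R b"
      using * by (auto simp: in_segment)
    have "a \<bullet> v j = lam j" if "j \<in> A" for j
    proof (rule ccontr)
      assume "a \<bullet> v j \<noteq> lam j"
      then have "a \<bullet> v j < lam j" "b \<bullet> v j \<le> lam j" "x \<bullet> v j = lam j"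
        using * assms that by (auto simp: order.strict_iff_order)
      then have "(1 - t) * (a \<bullet> v j) < (1 - t) * lam j" "t * (b \<bullet> v j) \<le> t * lam j"
        using t by auto
      moreover have "(1 - t) * (a \<bullet> v j) + t * (b \<bullet> v j) = lam j"
        using \<open>x \<bullet> v j = lam j\<close> t(3) by (simp add: inner_add_left)
      ultimately show False by (simp add: algebra_simps)
    qed
    then show "a \<in> ?F" using * by blast
  qed
  fix a b x assume *: "a \<in> \<Delta>" "b \<in> \<Delta>" "x \<in> ?F" "x \<in> open_segment a b"
  show "a \<in> ?F" using tight * by blast
  show "b \<in> ?F" using tight[of b a x] * by (simp add: open_segment_commute)
qed

text \<open>The constraints that are not tight at \<open>q\<close> have positive slack, hence tolerate a small
  move in either direction.\<close>

lemma slack_perturbation: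
  fixes v :: "'d::finite \<Rightarrow> 'a::euclidean_space"
  assumes \<Delta>: "\<Delta> = {x. \<forall>i. x \<bullet> v i \<le> lam i}" and q: "q \<in> \<Delta>"
    and d: "\<And>j. q \<bullet> v j = lam j \<Longrightarrow> d \<bullet> v j = 0"
  shows "\<exists>e>0. q + e *\<^sub>R d \<in> \<Delta> \<and> q - e *\<^sub>R d \<in> \<Delta>"
proof -
  have "\<forall>\<^sub>F e in at_right 0. \<bar>e * (d \<bullet> v j)\<bar> \<le> lam j - q \<bullet> v j" for j
  proof (cases "q \<bullet> v j = lam j")
    case True
    then show ?thesis using d by simp
  next
    case False
    then have "lam j - q \<bullet> v j > 0" using q \<Delta> by (auto simp: order.strict_iff_order)
    moreover have "((\<lambda>e. \<bar>e * (d \<bullet> v j)\<bar>) \<longlongrightarrow> \<bar>0 * (d \<bullet> v j)\<bar>) (at_right 0)"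
      by (intro tendsto_intros)
    ultimately have "\<forall>\<^sub>F e in at_right 0. \<bar>e * (d \<bullet> v j)\<bar> < lam j - q \<bullet> v j"
      by (auto intro: order_tendstoD)
    then show ?thesis by (rule eventually_mono) simp
  qed
  then have "\<forall>\<^sub>F e in at_right 0. \<forall>j. \<bar>e * (d \<bullet> v j)\<bar> \<le> lam j - q \<bullet> v j"
    by (simp add: eventually_all_finite)
  then obtain b where b: "b > 0" "\<And>e. 0 < e \<Longrightarrow> e < b \<Longrightarrow> \<forall>j. \<bar>e * (d \<bullet> v j)\<bar> \<le> lam j - q \<bullet> v j"
    unfolding eventually_at_right_field by auto
  have h: "\<bar>b / 2 * (d \<bullet> v j)\<bar> \<le> lam j - q \<bullet> v j" for j using b(2)[of "b/2"] b(1) by simp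
  have "q + (b/2) *\<^sub>R d \<in> \<Delta>" "q - (b/2) *\<^sub>R d \<in> \<Delta>"
  proof -
    have "(q + (b/2) *\<^sub>R d) \<bullet> v j \<le> lam j" "(q - (b/2) *\<^sub>R d) \<bullet> v j \<le> lam j" for j
      using h[of j] unfolding inner_add_left inner_diff_left inner_scaleR_left by linarith+
    then show "q + (b/2) *\<^sub>R d \<in> \<Delta>" "q - (b/2) *\<^sub>R d \<in> \<Delta>" using \<Delta> by blast+
  qed
  then show ?thesis using b(1) half_gt_zero by blast
qed

text \<open>Cut \<open>\<Delta>\<close> by a hyperplane \<open>c \<bullet> x = h\<close> that separates \<open>p\<close> from the other vertices. The slice
  is the hull of its extreme points, and each of these lies on an edge of \<open>\<Delta>\<close> through \<open>p\<close>. The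
  segment from \<open>p\<close> to any other vertex meets the slice, so a convex cone that contains the
  directions of the edges at \<open>p\<close> contains the directions of all vertices.\<close>

lemma polytope_subset_vertex_cone:
  fixes v :: "'d::finite \<Rightarrow> 'a::euclidean_space"
  assumes P: "polytope \<Delta>" and \<Delta>: "\<Delta> = {x. \<forall>i. x \<bullet> v i \<le> lam i}"
    and p: "p extreme_point_of \<Delta>"
    and K: "convex K" "0 \<in> K" "\<And>y t. y \<in> K \<Longrightarrow> 0 \<le> t \<Longrightarrow> t *\<^sub>R y \<in> K"
    and edge: "\<And>E y. E edge_of \<Delta> \<Longrightarrow> p \<in> E \<Longrightarrow> y \<in> E \<Longrightarrow> y - p \<in> K"
    and y: "y \<in> \<Delta>"
  shows "y - p \<in> K"
proof -
  have cc: "compact \<Delta>" "convex \<Delta>"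
    using P by (auto simp: polytope_imp_compact polytope_imp_convex)
  then have hull: "\<Delta> = convex hull {x. x extreme_point_of \<Delta>}" by (rule Krein_Milman_Minkowski)
  have conv: "convex {y. y - p \<in> K}"
  proof -
    have "{y. y - p \<in> K} = (\<lambda>y. p + y) ` K" by (auto intro!: image_eqI[of _ _ "_ - p"])
    then show ?thesis using K(1) by (simp add: convex_translation)
  qed
  let ?V = "{x. x extreme_point_of \<Delta>}"
  have fin: "finite ?V"
    using P by (simp add: finite_polyhedron_extreme_points polytope_imp_polyhedron)
  have pD: "p \<in> \<Delta>" using p by (simp add: extreme_point_of_def)
  have "{p} exposed_face_of \<Delta>"
    using p P exposed_face_of_polyhedron[of \<Delta> "{p}"]
    by (simp add: polytope_imp_polyhedron face_of_singleton)
  then obtain c b where cb: "\<Delta> \<subseteq> {x. c \<bullet> x \<le> b}" "{p} = \<Delta> \<inter> {x. c \<bullet> x = b}"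
    by (auto simp: exposed_face_of_def)
  then have cp: "c \<bullet> p = b" by auto
  have cless: "c \<bullet> x < c \<bullet> p" if "x \<in> \<Delta>" "x \<noteq> p" for x
    using cb cp that by (auto simp: order.strict_iff_order)
  \<comment> \<open>\<open>h\<close> lies strictly between the value of \<open>c\<close> at \<open>p\<close> and its values at the other vertices.\<close>
  obtain h where h: "h < c \<bullet> p" "\<And>x. x \<in> ?V \<Longrightarrow> x \<noteq> p \<Longrightarrow> c \<bullet> x < h"
  proof (cases "?V - {p} = {}")
    case True
    then show ?thesis using that[of "c \<bullet> p - 1"] by auto
  next
    case False
    define M where "M = Max ((\<lambda>x. c \<bullet> x) ` (?V - {p}))"
    have M: "c \<bullet> x \<le> M" if "x \<in> ?V" "x \<noteq> p" for x
      unfolding M_def using fin that by (intro Max_ge) auto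
    have "M \<in> (\<lambda>x. c \<bullet> x) ` (?V - {p})" unfolding M_def using fin False by (intro Max_in) auto
    then have "M < c \<bullet> p" using cless by (auto simp: extreme_point_of_def)
    then show ?thesis using that[of "(M + c \<bullet> p) / 2"] M by (fastforce simp: field_simps)
  qed
  define S where "S = \<Delta> \<inter> {x. c \<bullet> x = h}"
  have S: "compact S" "convex S"
    using cc by (auto simp: S_def compact_Int_closed closed_hyperplane convex_Int convex_hyperplane)
  have q_in: "q - p \<in> K" if q: "q extreme_point_of S" for q
  proof -
    have qS: "q \<in> \<Delta>" "c \<bullet> q = h" using q by (auto simp: S_def extreme_point_of_def)
    \<comment> \<open>\<open>F\<close> is the smallest face of \<open>\<Delta>\<close> containing \<open>q\<close>; \<open>zero\<close> bounds its dimension by one.\<close>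
    define F where "F = {x \<in> \<Delta>. \<forall>j\<in>{j. q \<bullet> v j = lam j}. x \<bullet> v j = lam j}"
    have F: "F face_of \<Delta>" unfolding F_def by (rule tight_face[OF \<Delta>])
    have qF: "q \<in> F" using qS by (simp add: F_def)
    have zero: "d = 0" if tan: "\<And>j. q \<bullet> v j = lam j \<Longrightarrow> d \<bullet> v j = 0" and "c \<bullet> d = 0" for d
    proof (rule ccontr)
      assume "d \<noteq> 0"
      obtain e where e: "e > 0" "q + e *\<^sub>R d \<in> \<Delta>" "q - e *\<^sub>R d \<in> \<Delta>"
        using slack_perturbation[OF \<Delta> qS(1) tan] by blast
      have "q + e *\<^sub>R d \<in> S" "q - e *\<^sub>R d \<in> S"
        using e qS that(2) by (auto simp: S_def inner_add_right inner_diff_right)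
      moreover have "q \<in> open_segment (q + e *\<^sub>R d) (q - e *\<^sub>R d)"
      proof -
        have "midpoint (q + e *\<^sub>R d) (q - e *\<^sub>R d) = (1/2) *\<^sub>R (2 *\<^sub>R q)"
          by (simp add: midpoint_def scaleR_2)
        then have mid: "midpoint (q + e *\<^sub>R d) (q - e *\<^sub>R d) = q" by simp
        have "e *\<^sub>R d \<noteq> - (e *\<^sub>R d)" using e \<open>d \<noteq> 0\<close> by (simp add: eq_neg_iff_add_eq_0 flip: scaleR_2)
        then have "q + e *\<^sub>R d \<noteq> q - e *\<^sub>R d" by (metis add_left_imp_eq uminus_add_conv_diff add.commute)
        then show ?thesis
          using midpoint_in_open_segment[of "q + e *\<^sub>R d" "q - e *\<^sub>R d"] mid by simp
      qed
      ultimately show False using q by (auto simp: extreme_point_of_def)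
    qed
    have "p \<in> F"
    proof -
      have "compact F" "convex F" using face_of_imp_compact[OF cc(2,1) F] face_of_imp_convex[OF F] by auto
      then have FH: "F = convex hull {x. x extreme_point_of F}" by (rule Krein_Milman_Minkowski)
      \<comment> \<open>A vertex of \<open>F\<close> on the near side of the hyperplane can only be \<open>p\<close>.\<close>
      have "\<exists>e. e extreme_point_of F \<and> h \<le> c \<bullet> e"
      proof (rule ccontr)
        assume "\<not> ?thesis"
        then have "{x. x extreme_point_of F} \<subseteq> {x. c \<bullet> x < h}" by auto
        then have "F \<subseteq> {x. c \<bullet> x < h}"
          using FH hull_minimal[of _ "{x. c \<bullet> x < h}" convex] convex_halfspace_lt by metis
        then show False using qF qS by auto
      qed
      then obtain e where e: "e extreme_point_of F" "h \<le> c \<bullet> e" by blast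
      have "e extreme_point_of \<Delta>" using e extreme_point_of_face[OF F] by blast
      then have "e = p" using h(2)[of e] e by force
      then show "p \<in> F" using e by (simp add: extreme_point_of_def)
    qed
    have cpq: "c \<bullet> (p - q) > 0" using h(1) qS by (simp add: inner_diff_right)
    have sub: "F \<subseteq> affine hull {p, q}"
    proof
      fix x assume x: "x \<in> F"
      define t where "t = c \<bullet> (x - q) / (c \<bullet> (p - q))"
      have "(x - q) - t *\<^sub>R (p - q) = 0"
      proof (rule zero)
        fix j assume "q \<bullet> v j = lam j"
        then show "((x - q) - t *\<^sub>R (p - q)) \<bullet> v j = 0"
          using x \<open>p \<in> F\<close> by (simp add: F_def inner_diff_left)
      next
        show "c \<bullet> ((x - q) - t *\<^sub>R (p - q)) = 0"
          using cpq by (simp add: t_def inner_diff_right[of c "x - q"])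
      qed
      then have "x = t *\<^sub>R p + (1 - t) *\<^sub>R q" by (simp add: algebra_simps)
      then show "x \<in> affine hull {p, q}" unfolding affine_hull_2 by force
    qed
    have "p \<noteq> q" using cpq by auto
    have "aff_dim F = 1"
    proof (rule antisym)
      show "aff_dim F \<le> 1" using aff_dim_subset[OF sub] \<open>p \<noteq> q\<close> by simp
      show "1 \<le> aff_dim F" using aff_dim_subset[of "{p, q}" F] qF \<open>p \<in> F\<close> \<open>p \<noteq> q\<close> by simp
    qed
    then have "F edge_of \<Delta>" using F by (simp add: edge_of_def)
    then show ?thesis using edge qF \<open>p \<in> F\<close> by blast
  qed
  have S_in: "r - p \<in> K" if "r \<in> S" for r
  proof -
    have "S = convex hull {x. x extreme_point_of S}" using S by (rule Krein_Milman_Minkowski)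
    also have "\<dots> \<subseteq> {y. y - p \<in> K}" using q_in conv by (intro hull_minimal) auto
    finally show ?thesis using that by auto
  qed
  have "?V \<subseteq> {y. y - p \<in> K}"
  proof
    fix y assume y: "y \<in> ?V"
    show "y \<in> {y. y - p \<in> K}"
    proof (cases "y = p")
      case True
      then show ?thesis using K(2) by simp
    next
      case False
      have yD: "y \<in> \<Delta>" using y by (simp add: extreme_point_of_def)
      have yh: "c \<bullet> y < h" using h(2) y False by simp
      define s where "s = (c \<bullet> p - h) / (c \<bullet> p - c \<bullet> y)"
      have s: "0 < s" "s \<le> 1" using yh h(1) by (auto simp: s_def field_simps)
      have "(1 - s) *\<^sub>R p + s *\<^sub>R y \<in> \<Delta>"
        using cc(2) pD yD s by (intro convexD_alt) auto
      moreover have "c \<bullet> ((1 - s) *\<^sub>R p + s *\<^sub>R y) = h"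
      proof -
        have "s * (c \<bullet> p - c \<bullet> y) = c \<bullet> p - h" using yh h(1) by (simp add: s_def)
        then show ?thesis by (simp add: inner_add_right algebra_simps)
      qed
      ultimately have "(1 - s) *\<^sub>R p + s *\<^sub>R y - p \<in> K" using S_in by (simp add: S_def)
      then have "(1 / s) *\<^sub>R ((1 - s) *\<^sub>R p + s *\<^sub>R y - p) \<in> K" using K(3) s by simp
      moreover have "(1 - s) *\<^sub>R p + s *\<^sub>R y - p = s *\<^sub>R (y - p)" by (simp add: algebra_simps)
      ultimately show ?thesis using s by simp
    qed
  qed
  then have "convex hull ?V \<subseteq> {y. y - p \<in> K}" using conv by (intro hull_minimal)
  then show ?thesis using hull y by blast
qed

lemma lattice_basis_span:
  fixes u :: "'n \<Rightarrow> real ^ 'n"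
  assumes "lattice_basis u"
  shows "span (range u) = UNIV"
proof -
  have "b \<in> span (range u)" if b: "b \<in> Basis" for b :: "real ^ 'n"
  proof -
    have "b \<in> int_lattice" using b by (auto simp: int_lattice_def Basis_vec_def axis_def)
    then obtain c :: "'n \<Rightarrow> int" where "b = (\<Sum>i\<in>UNIV. of_int (c i) *\<^sub>R u i)"
      using assms unfolding lattice_basis_def by blast
    then show ?thesis by (auto intro!: span_sum span_scale intro: span_base)
  qed
  then have "span Basis \<subseteq> span (range u)" by (intro span_minimal) auto
  then show ?thesis by auto
qed

text \<open>By the cone property every point of \<open>\<Delta>\<close> is \<open>p + (\<Sum>i. c i u_i)\<close> with \<open>c \<ge> 0\<close>. A facet
  through \<open>p\<close> has dimension \<open>n - 1\<close>, so its normal is orthogonal to all edge directions except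
  one; and that one, \<open>\<tau> j\<close>, determines the facet. Pairing a linear relation between the normals
  with \<open>u (\<tau> k)\<close> isolates the coefficient of \<open>v k\<close>.\<close>

lemma delzant_vertex_normals_independent:
  fixes v :: "'d::finite \<Rightarrow> real ^ 'n"
  assumes D: "delzant_polytope \<Delta>" and fp: "facet_presentation \<Delta> v lam"
    and p: "p extreme_point_of \<Delta>"
    and \<xi>: "(\<Sum>j\<in>UNIV. \<xi> j *\<^sub>R v j) = 0" "\<And>j. p \<bullet> v j \<noteq> lam j \<Longrightarrow> \<xi> j = 0"
  shows "\<xi> k = 0"
proof (cases "p \<bullet> v k = lam k")
  case True
  have P: "polytope \<Delta>" using D by (simp add: delzant_polytope_def)
  have \<Delta>: "\<Delta> = {x. \<forall>i. x \<bullet> v i \<le> lam i}" using fp unfolding facet_presentation_def by blast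
  have pD: "p \<in> \<Delta>" using p by (simp add: extreme_point_of_def)
  obtain e u where e: "bij_betw e (UNIV::'n set) {E. E edge_of \<Delta> \<and> p \<in> E}"
    and u: "\<And>i. \<exists>t>0. e i = closed_segment p (p + t *\<^sub>R u i)" and lb: "lattice_basis u"
    using D p unfolding delzant_polytope_def by blast
  note sp = lattice_basis_span[OF lb]
  have vnz: "v j \<noteq> 0" for j
    using fp unfolding facet_presentation_def primitive_vector_def by blast
  have bij: "bij_betw (\<lambda>j. \<Delta> \<inter> {x. x \<bullet> v j = lam j}) UNIV {F. F facet_of \<Delta>}"
    using fp unfolding facet_presentation_def by blast
  define K where "K = {\<Sum>i\<in>UNIV. c i *\<^sub>R u i |c. \<forall>i. 0 \<le> c i}"
  have KI: "y \<in> K" if "\<And>i. 0 \<le> c i" "y = (\<Sum>i\<in>UNIV. c i *\<^sub>R u i)" for c y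
    unfolding K_def using that by blast
  have cone: "y - p \<in> K" if "y \<in> \<Delta>" for y
  proof (rule polytope_subset_vertex_cone[OF P \<Delta> p _ _ _ _ that])
    show "0 \<in> K" by (rule KI[of "\<lambda>_. 0"]) auto
    show "t *\<^sub>R y \<in> K" if y: "y \<in> K" and t: "0 \<le> t" for y t
    proof -
      obtain c where "y = (\<Sum>i\<in>UNIV. c i *\<^sub>R u i)" "\<forall>i. 0 \<le> c i" using y by (auto simp: K_def)
      then show ?thesis using t
        by (intro KI[of "\<lambda>i. t * c i"]) (auto simp: scaleR_sum_right)
    qed
    show "convex K"
    proof (rule convexI)
      fix x y and a b :: real
      assume *: "x \<in> K" "y \<in> K" "0 \<le> a" "0 \<le> b" "a + b = 1"
      obtain c where "x = (\<Sum>i\<in>UNIV. c i *\<^sub>R u i)" "\<forall>i. 0 \<le> c i" using * by (auto simp: K_def)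
      moreover obtain c' where "y = (\<Sum>i\<in>UNIV. c' i *\<^sub>R u i)" "\<forall>i. 0 \<le> c' i" using * by (auto simp: K_def)
      ultimately show "a *\<^sub>R x + b *\<^sub>R y \<in> K" using *(3,4)
        by (intro KI[of "\<lambda>i. a * c i + b * c' i"])
           (auto simp: scaleR_sum_right scaleR_left_distrib sum.distrib)
    qed
    fix E y assume E: "E edge_of \<Delta>" "p \<in> E" and yE: "y \<in> E"
    have "E \<in> range e" using E bij_betw_imp_surj_on[OF e] by blast
    then obtain i where i: "E = e i" by blast
    obtain t where t: "t > 0" "e i = closed_segment p (p + t *\<^sub>R u i)" using u by blast
    obtain r where r: "0 \<le> r" "r \<le> 1" "y = (1 - r) *\<^sub>R p + r *\<^sub>R (p + t *\<^sub>R u i)"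
      using yE i t by (auto simp: in_segment)
    have "y - p = (r * t) *\<^sub>R u i" unfolding r(3) by (simp add: scaleR_left_diff_distrib scaleR_add_right)
    also have "\<dots> = (\<Sum>l\<in>UNIV. if l = i then (r * t) *\<^sub>R u l else 0)" by simp
    also have "\<dots> = (\<Sum>l\<in>UNIV. (if l = i then r * t else 0) *\<^sub>R u l)"
      by (rule sum.cong) auto
    finally show "y - p \<in> K" using r t by (intro KI[of "\<lambda>l. if l = i then r * t else 0"]) auto
  qed
  have pu: "\<exists>t>0. p + t *\<^sub>R u i \<in> \<Delta>" for i
  proof -
    obtain t where t: "t > 0" "e i = closed_segment p (p + t *\<^sub>R u i)" using u by blast
    have "e i edge_of \<Delta>" using bij_betw_imp_surj_on[OF e] by blast
    then have "e i \<subseteq> \<Delta>" by (rule edge_of_imp_subset)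
    then show ?thesis using t by auto
  qed
  have le: "u i \<bullet> v j \<le> 0" if "p \<bullet> v j = lam j" for i j
  proof -
    obtain t where t: "t > 0" "p + t *\<^sub>R u i \<in> \<Delta>" using pu by blast
    then have "(p + t *\<^sub>R u i) \<bullet> v j \<le> lam j" using \<Delta> by blast
    then have "t * (u i \<bullet> v j) \<le> 0" using that by (simp add: inner_add_left)
    then show ?thesis using t by (simp add: mult_le_0_iff)
  qed
  have dimD: "aff_dim \<Delta> = int (CARD('n))"
  proof -
    have "u i \<in> span ((+) (- p) ` \<Delta>)" for i
    proof -
      obtain t where t: "t > 0" "p + t *\<^sub>R u i \<in> \<Delta>" using pu by blast
      then have "t *\<^sub>R u i \<in> (+) (- p) ` \<Delta>" by (force intro: image_eqI[of _ _ "p + t *\<^sub>R u i"])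
      then have "(1/t) *\<^sub>R (t *\<^sub>R u i) \<in> span ((+) (- p) ` \<Delta>)" by (intro span_scale span_base)
      then show ?thesis using t by simp
    qed
    then have "span (range u) \<subseteq> span ((+) (- p) ` \<Delta>)" by (intro span_minimal) auto
    then have "span ((+) (- p) ` \<Delta>) = UNIV" using sp by auto
    then have "dim ((+) (- p) ` \<Delta>) = CARD('n)" by (metis dim_UNIV DIM_cart DIM_real dim_span nat_mult_1_right)
    then show ?thesis using aff_dim_eq_dim[of p \<Delta>] pD by (simp add: hull_inc)
  qed
  let ?f = "\<lambda>j. \<Delta> \<inter> {x. x \<bullet> v j = lam j}"
  have in_facet: "x \<in> ?f j \<longleftrightarrow> x \<in> \<Delta> \<and> (\<Sum>i\<in>UNIV. c i * (u i \<bullet> v j)) = 0"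
    if "p \<bullet> v j = lam j" "x - p = (\<Sum>i\<in>UNIV. c i *\<^sub>R u i)" for x j c
  proof -
    have "x = p + (\<Sum>i\<in>UNIV. c i *\<^sub>R u i)" using that(2) by (simp add: algebra_simps)
    then have "x \<bullet> v j = lam j + (\<Sum>i\<in>UNIV. c i * (u i \<bullet> v j))"
      using that(1) by (simp add: inner_add_left inner_sum_left)
    then show ?thesis by auto
  qed
  have uniq: "\<exists>i. u i \<bullet> v j < 0 \<and> (\<forall>l. l \<noteq> i \<longrightarrow> u l \<bullet> v j = 0)" if j: "p \<bullet> v j = lam j" for j
  proof -
    have "\<exists>i. u i \<bullet> v j \<noteq> 0"
    proof (rule ccontr)
      assume "\<not> ?thesis"
      then have uv: "v j \<bullet> u i = 0" for i by (simp add: inner_commute)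
      have "orthogonal (v j) z" if "z \<in> span (range u)" for z
        by (rule orthogonal_to_span[OF that]) (use uv in \<open>auto simp: orthogonal_def\<close>)
      then have "v j = 0" using sp orthogonal_self by blast
      then show False using vnz by blast
    qed
    then obtain i where "u i \<bullet> v j \<noteq> 0" by blast
    then have i: "u i \<bullet> v j < 0" using le[OF j, of i] by linarith
    have "u l \<bullet> v j = 0" if "l \<noteq> i" for l
    proof (rule ccontr)
      assume "u l \<bullet> v j \<noteq> 0"
      then have l: "u l \<bullet> v j < 0" using le[OF j, of l] by linarith
      \<comment> \<open>Otherwise the facet lies in the span of only \<open>n - 2\<close> edge directions.\<close>
      have sub: "(+) (- p) ` ?f j \<subseteq> span (u ` (UNIV - {i, l}))"
      proof (rule image_subsetI)
        fix x assume x: "x \<in> ?f j"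
        then obtain c where c: "x - p = (\<Sum>i\<in>UNIV. c i *\<^sub>R u i)" "\<forall>i. 0 \<le> c i"
          using cone[of x] by (auto simp: K_def)
        have "(\<Sum>i\<in>UNIV. - (c i * (u i \<bullet> v j))) = 0"
          using in_facet[OF j c(1)] x by (simp add: sum_negf)
        then have cm: "c m * (u m \<bullet> v j) = 0" for m
        proof -
          have "0 \<le> - (c i * (u i \<bullet> v j))" for i
            using mult_nonneg_nonpos[of "c i" "u i \<bullet> v j"] c(2) le[OF j] by simp
          then show ?thesis
            using sum_nonneg_eq_0_iff[of UNIV "\<lambda>i. - (c i * (u i \<bullet> v j))"]
              \<open>(\<Sum>i\<in>UNIV. - (c i * (u i \<bullet> v j))) = 0\<close> by simp
        qed
        have "c i = 0" "c l = 0" using i l cm[of i] cm[of l] by auto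
        then have "(\<Sum>i\<in>UNIV. c i *\<^sub>R u i) = (\<Sum>m\<in>UNIV - {i, l}. c m *\<^sub>R u m)"
          by (intro sum.mono_neutral_right) auto
        then have "x - p \<in> span (u ` (UNIV - {i, l}))"
          using c by (auto intro!: span_sum span_scale intro: span_base)
        then show "- p + x \<in> span (u ` (UNIV - {i, l}))" by simp
      qed
      have "dim ((+) (- p) ` ?f j) \<le> card (u ` (UNIV - {i, l}))"
        by (rule dim_le_card[OF sub]) simp
      also have "\<dots> \<le> CARD('n) - 2"
        using card_image_le[of "UNIV - {i, l}" u] \<open>l \<noteq> i\<close> by (simp add: card_Diff_subset)
      finally have 1: "dim ((+) (- p) ` ?f j) \<le> CARD('n) - 2" .
      have "card {i, l} \<le> CARD('n)" by (rule card_mono) auto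
      then have 2: "2 \<le> CARD('n)" using \<open>l \<noteq> i\<close> by simp
      have "?f j facet_of \<Delta>" using bij_betw_imp_surj_on[OF bij] by blast
      then have "aff_dim (?f j) = int (CARD('n)) - 1" using dimD by (simp add: facet_of_def)
      moreover have "aff_dim (?f j) = int (dim ((+) (- p) ` ?f j))"
        using pD j by (intro aff_dim_eq_dim hull_inc) auto
      ultimately show False using 1 2 by linarith
    qed
    then show ?thesis using i by blast
  qed
  define \<tau> where "\<tau> j = (SOME i. u i \<bullet> v j < 0 \<and> (\<forall>l. l \<noteq> i \<longrightarrow> u l \<bullet> v j = 0))" for j
  have \<tau>: "u (\<tau> j) \<bullet> v j < 0" "\<And>l. l \<noteq> \<tau> j \<Longrightarrow> u l \<bullet> v j = 0" if "p \<bullet> v j = lam j" for j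
    using someI_ex[OF uniq[OF that]] unfolding \<tau>_def by blast+
  have inj: "j = k" if "p \<bullet> v j = lam j" "\<tau> j = \<tau> k" for j
  proof -
    have "?f j = ?f k"
    proof (rule set_eqI)
      fix x
      show "x \<in> ?f j \<longleftrightarrow> x \<in> ?f k"
      proof (cases "x \<in> \<Delta>")
        case xD: True
        then obtain c where c: "x - p = (\<Sum>i\<in>UNIV. c i *\<^sub>R u i)"
          using cone[of x] by (auto simp: K_def)
        have *: "(\<Sum>i\<in>UNIV. c i * (u i \<bullet> v m)) = c (\<tau> k) * (u (\<tau> k) \<bullet> v m)"
          if "p \<bullet> v m = lam m" "\<tau> m = \<tau> k" for m
          using \<tau>[OF that(1)] that(2) sum.mono_neutral_right[of UNIV "{\<tau> k}" "\<lambda>i. c i * (u i \<bullet> v m)"]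
          by auto
        show ?thesis
          using in_facet[OF that(1) c] in_facet[OF True c] *[OF that] *[OF True] \<tau>(1)[OF that(1)]
            \<tau>(1)[OF True] that(2) xD by auto
      qed auto
    qed
    then show ?thesis using bij_betw_imp_inj_on[OF bij] by (meson UNIV_I inj_on_def)
  qed
  have "0 = (\<Sum>j\<in>UNIV. \<xi> j *\<^sub>R v j) \<bullet> u (\<tau> k)" using \<xi>(1) by simp
  also have "\<dots> = (\<Sum>j\<in>UNIV. \<xi> j * (u (\<tau> k) \<bullet> v j))"
    unfolding inner_sum_left by (simp add: inner_commute)
  also have "\<dots> = (\<Sum>j\<in>{k}. \<xi> j * (u (\<tau> k) \<bullet> v j))"
  proof (rule sum.mono_neutral_right)
    show "\<forall>j\<in>UNIV - {k}. \<xi> j * (u (\<tau> k) \<bullet> v j) = 0"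
    proof
      fix j assume "j \<in> UNIV - {k}"
      then show "\<xi> j * (u (\<tau> k) \<bullet> v j) = 0"
        using \<xi>(2)[of j] \<tau>(2)[of j "\<tau> k"] inj[of j] by fastforce
    qed
  qed auto
  finally show ?thesis using \<tau>(1)[OF True] by simp
qed (use \<xi> in simp)

text \<open>The smallest face containing \<open>x\<close> has a vertex, and every constraint tight at \<open>x\<close> is tight
  there.\<close>

lemma delzant_normals_independent:
  fixes v :: "'d::finite \<Rightarrow> real ^ 'n"
  assumes D: "delzant_polytope \<Delta>" and fp: "facet_presentation \<Delta> v lam"
    and x: "x \<in> \<Delta>"
    and \<xi>: "(\<Sum>j\<in>UNIV. \<xi> j *\<^sub>R v j) = 0" "\<And>j. x \<bullet> v j \<noteq> lam j \<Longrightarrow> \<xi> j = 0"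
  shows "\<xi> k = 0"
proof -
  have P: "polytope \<Delta>" using D by (simp add: delzant_polytope_def)
  have \<Delta>: "\<Delta> = {x. \<forall>i. x \<bullet> v i \<le> lam i}" using fp unfolding facet_presentation_def by blast
  define F where "F = {y \<in> \<Delta>. \<forall>j\<in>{j. x \<bullet> v j = lam j}. y \<bullet> v j = lam j}"
  have F: "F face_of \<Delta>" unfolding F_def by (rule tight_face[OF \<Delta>])
  have "x \<in> F" using x by (simp add: F_def)
  moreover have "compact F" "convex F"
    using face_of_imp_compact[OF _ _ F] face_of_imp_convex[OF F] P
    by (auto simp: polytope_imp_compact polytope_imp_convex)
  ultimately obtain p where p: "p extreme_point_of F" using extreme_point_exists_convex by blast
  then have "p extreme_point_of \<Delta>" "p \<in> F" using extreme_point_of_face[OF F] by blast+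
  then show ?thesis
    using delzant_vertex_normals_independent[OF D fp, of p \<xi> k] \<xi> by (auto simp: F_def)
qed

lemma linear_proj_pi: "linear (proj_pi v)"
  unfolding proj_pi_def
  by (rule linearI) (simp_all add: scaleR_left_distrib sum.distrib scaleR_sum_right)

lemma subspace_lie_N: "subspace (lie_N v)"
  unfolding lie_N_def by (rule linear_subspace_kernel[OF linear_proj_pi])

text \<open>The annihilator of the kernel of \<open>proj_pi v\<close> is the range of its adjoint.\<close>

lemma lie_N_orthogonal_imp_image:
  fixes v :: "'d::finite \<Rightarrow> real ^ 'n" and q :: "real ^ 'd"
  assumes "\<And>\<xi>. \<xi> \<in> lie_N v \<Longrightarrow> q \<bullet> \<xi> = 0"
  obtains x where "\<And>j. q $ j = x \<bullet> v j"
proof -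
  have "q \<in> (range (adjoint (proj_pi v)))\<^sup>\<bottom>\<^sup>\<bottom>"
    using assms ker_orthogonal_comp_adjoint[OF linear_proj_pi[of v]]
    by (auto simp: orthogonal_comp_def orthogonal_def lie_N_def inner_commute vimage_def)
  then have "q \<in> range (adjoint (proj_pi v))"
    by (metis UNIV_I adjoint_linear linear_proj_pi linear_subspace_image orthogonal_comp_self subspace_UNIV)
  then obtain x where x: "q = adjoint (proj_pi v) x" by blast
  have "q $ j = x \<bullet> v j" for j
  proof -
    have "q $ j = q \<bullet> axis j 1" by (simp add: inner_axis)
    also have "\<dots> = x \<bullet> proj_pi v (axis j 1)"
      using adjoint_works[OF linear_proj_pi[of v], of "axis j 1" x] by (simp add: x inner_commute)
    also have "proj_pi v (axis j 1) = v j"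
      by (simp add: proj_pi_def axis_def if_distrib[of "\<lambda>a. a *\<^sub>R _"] cong: if_cong)
    finally show ?thesis .
  qed
  then show ?thesis by (rule that)
qed

text \<open>Such a \<open>q\<close> is \<open>(x \<bullet> v_j)\<close> for some \<open>x\<close>, and nonnegativity makes the ray in direction
  \<open>- x\<close> from any point of \<open>\<Delta>\<close> stay in \<open>\<Delta>\<close>, which is bounded.\<close>

lemma delzant_recession_trivial:
  fixes v :: "'d::finite \<Rightarrow> real ^ 'n" and q :: "real ^ 'd"
  assumes D: "delzant_polytope \<Delta>" and fp: "facet_presentation \<Delta> v lam"
    and q: "\<And>j. 0 \<le> q $ j" "\<And>\<xi>. \<xi> \<in> lie_N v \<Longrightarrow> q \<bullet> \<xi> = 0"
  shows "q = 0"
proof -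
  have \<Delta>: "\<Delta> = {x. \<forall>i. x \<bullet> v i \<le> lam i}" using fp unfolding facet_presentation_def by blast
  obtain x where x: "\<And>j. q $ j = x \<bullet> v j" using lie_N_orthogonal_imp_image[OF q(2)] by blast
  obtain p where p: "p \<in> \<Delta>" using D by (auto simp: delzant_polytope_def)
  obtain B where B: "\<And>y. y \<in> \<Delta> \<Longrightarrow> norm y \<le> B"
    using D polytope_imp_bounded bounded_iff unfolding delzant_polytope_def by metis
  have "x = 0"
  proof (rule ccontr)
    assume "x \<noteq> 0"
    \<comment> \<open>Far enough for \<open>p - t x\<close> to leave the ball of radius \<open>B\<close>.\<close>
    define t where "t = (B + norm p + 1) / norm x"
    have "norm p \<le> B" using B p by blast
    then have "0 \<le> B + norm p + 1" using norm_ge_zero[of p] by linarith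
    then have "t \<ge> 0" by (simp add: t_def)
    have "(p - t *\<^sub>R x) \<bullet> v j \<le> lam j" for j
    proof -
      have "0 \<le> t * (x \<bullet> v j)" using q(1)[of j] x \<open>t \<ge> 0\<close> by simp
      moreover have "p \<bullet> v j \<le> lam j" using p \<Delta> by blast
      ultimately show ?thesis by (simp add: inner_diff_left)
    qed
    then have "norm (p - t *\<^sub>R x) \<le> B" using B \<Delta> by blast
    moreover have "norm (t *\<^sub>R x) \<le> norm p + norm (p - t *\<^sub>R x)"
      by (metis norm_triangle_sub norm_minus_commute)
    moreover have "norm (t *\<^sub>R x) = B + norm p + 1"
      using \<open>x \<noteq> 0\<close> \<open>0 \<le> B + norm p + 1\<close> by (simp add: t_def)
    ultimately show False by simp
  qed
  then have "q $ j = 0" for j using x[of j] by simp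
  then show ?thesis by (simp add: vec_eq_iff)
qed

text \<open>A point \<open>z\<close> of the level set lies over the point \<open>x\<close> of \<open>\<Delta>\<close> with
  \<open>x \<bullet> v_j = lam_j - |z_j|^2 / 2\<close>, so \<open>z_j = 0\<close> exactly for the facets through \<open>x\<close>, and an
  element of \<open>lie_N v\<close> supported there is a linear relation between their normals.
  Geometrically: the action of \<open>N\<close> on the level set is locally free.\<close>

lemma level_Z_free:
  fixes v :: "'d::finite \<Rightarrow> real ^ 'n"
  assumes D: "delzant_polytope \<Delta>" and fp: "facet_presentation \<Delta> v lam"
    and z: "z \<in> level_Z v lam" and \<xi>: "\<xi> \<in> lie_N v" "\<And>j. z $ j \<noteq> 0 \<Longrightarrow> \<xi> $ j = 0"
  shows "\<xi> = 0"
proof -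
  have \<Delta>: "\<Delta> = {x. \<forall>i. x \<bullet> v i \<le> lam i}" using fp unfolding facet_presentation_def by blast
  obtain x where x: "\<And>j. moment_T lam z $ j = x \<bullet> v j"
    using lie_N_orthogonal_imp_image[of v "moment_T lam z"] z by (auto simp: level_Z_def)
  then have eq: "x \<bullet> v j = lam j - (cmod (z $ j))\<^sup>2 / 2" for j
    by (simp add: moment_T_def flip: x)
  then have "x \<in> \<Delta>" by (simp add: \<Delta>)
  moreover have "(\<Sum>j\<in>UNIV. (\<xi> $ j) *\<^sub>R v j) = 0" using \<xi>(1) by (simp add: lie_N_def proj_pi_def)
  ultimately have "\<xi> $ k = 0" for k
    using delzant_normals_independent[OF D fp, of x "\<lambda>j. \<xi> $ j" k] \<xi>(2) eq by fastforce
  then show ?thesis by (simp add: vec_eq_iff)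
qed

section \<open>Diagonal real multiplications and the complex structure on \<open>C^d\<close>\<close>

definition vmul :: "real ^ 'd \<Rightarrow> complex ^ 'd \<Rightarrow> complex ^ 'd" (infixr "\<odot>" 75)
  where "\<xi> \<odot> z = (\<chi> j. (\<xi> $ j) *\<^sub>R z $ j)"

abbreviation imul :: "complex ^ 'd \<Rightarrow> complex ^ 'd"
  where "imul z \<equiv> \<i> *s z"

lemma bounded_bilinear_vmul: "bounded_bilinear ((\<odot>) :: real ^ 'd::finite \<Rightarrow> _)"
  unfolding bilinear_conv_bounded_bilinear[symmetric]
  by (auto simp: bilinear_def vmul_def vec_eq_iff algebra_simps intro!: linearI)

lemma linear_imul: "linear (imul :: complex ^ 'd::finite \<Rightarrow> _)"
  by (rule linearI) (auto simp: vec_eq_iff algebra_simps)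

lemma bounded_linear_imul: "bounded_linear (imul :: complex ^ 'd::finite \<Rightarrow> _)"
  using linear_imul by (rule linear_conv_bounded_linear[THEN iffD1])

interpretation vmul: bounded_bilinear "(\<odot>) :: real ^ 'd::finite \<Rightarrow> _"
  by (rule bounded_bilinear_vmul)

lemmas imul_linear_simps =
  linear_add[OF linear_imul] linear_diff[OF linear_imul] linear_neg[OF linear_imul]
  linear_scale[OF linear_imul]

lemma vmul_imul: "\<xi> \<odot> imul z = imul (\<xi> \<odot> z)"
  and imul_imul: "imul (imul z) = - z"
  and vmul_commute: "\<xi> \<odot> \<zeta> \<odot> z = \<zeta> \<odot> \<xi> \<odot> z"
  by (auto simp: vmul_def vec_eq_iff complex_eq_iff)

lemma inner_imul_imul: "imul a \<bullet> imul b = a \<bullet> b"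
  and inner_imul_left: "imul a \<bullet> b = - (a \<bullet> imul b)"
  and inner_vmul_left: "(\<xi> \<odot> a) \<bullet> b = a \<bullet> (\<xi> \<odot> b)"
  by (auto simp: vmul_def inner_vec_def inner_complex_def sum_negf[symmetric] algebra_simps
      intro!: sum.cong)

lemma inner_vmul_imul_self: "a \<bullet> imul (\<xi> \<odot> a) = 0" "imul a \<bullet> (\<xi> \<odot> a) = 0"
  by (auto simp: vmul_def inner_vec_def inner_complex_def)

lemma inner_vmul_vmul_imul: "(\<xi> \<odot> a) \<bullet> imul (\<zeta> \<odot> a) = 0" "imul (\<xi> \<odot> a) \<bullet> (\<zeta> \<odot> a) = 0"
  by (auto simp: vmul_def inner_vec_def inner_complex_def)

lemma inner_vmul_self: "a \<bullet> (\<xi> \<odot> a) = \<xi> \<bullet> (\<chi> j. (cmod (a $ j))\<^sup>2)"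
proof -
  have c: "(cmod z)\<^sup>2 = Re z * Re z + Im z * Im z" for z
    by (simp add: cmod_power2 flip: power2_eq_square)
  show ?thesis
    by (auto intro!: sum.cong simp: vmul_def inner_vec_def inner_complex_def c algebra_simps)
qed

section \<open>Charts of a quotient by a torus\<close>

text \<open>The hypotheses isolate what the curvature computation uses of a local parametrization
  \<open>s\<close>: \<open>\<eta>\<close> is the connection form, giving the vertical part of \<open>ds\<close>; \<open>dims\<close> says that the
  coordinate space is at least as large as the horizontal space; and \<open>g\<close> agrees on \<open>U\<close> with the
  quotient metric, its values elsewhere being arbitrary.\<close>

locale torus_quotient_chart =
  fixes v :: "'d::finite \<Rightarrow> real ^ 'n"
    and U :: "'e::euclidean_space set"
    and s :: "'e \<Rightarrow> complex ^ 'd"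
    and \<eta> :: "'e \<Rightarrow> 'e \<Rightarrow> real ^ 'd"
    and g :: "'e \<Rightarrow> 'e \<Rightarrow> 'e \<Rightarrow> real"
  assumes U: "open U"
    and s: "smooth_on U s"
    and free: "\<And>x \<xi>. x \<in> U \<Longrightarrow> \<xi> \<in> lie_N v \<Longrightarrow> \<xi> \<odot> s x = 0 \<Longrightarrow> \<xi> = 0"
    and \<eta>_in: "\<And>x u. x \<in> U \<Longrightarrow> \<eta> x u \<in> lie_N v"
    and vert: "\<And>x u \<xi>. x \<in> U \<Longrightarrow> \<xi> \<in> lie_N v \<Longrightarrow>
      (dir_deriv s x u - imul (\<eta> x u \<odot> s x)) \<bullet> imul (\<xi> \<odot> s x) = 0"
    and level: "\<And>x u \<xi>. x \<in> U \<Longrightarrow> \<xi> \<in> lie_N v \<Longrightarrow> dir_deriv s x u \<bullet> (\<xi> \<odot> s x) = 0"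
    and immersion: "\<And>x u. x \<in> U \<Longrightarrow> dir_deriv s x u = imul (\<eta> x u \<odot> s x) \<Longrightarrow> u = 0"
    and dims: "2 * CARD('d) \<le> DIM('e) + 2 * dim (lie_N v)"
    and g: "\<And>x u w. x \<in> U \<Longrightarrow> g x u w =
      (dir_deriv s x u - imul (\<eta> x u \<odot> s x)) \<bullet> (dir_deriv s x w - imul (\<eta> x w \<odot> s x))"
begin

text \<open>The gauge covariant derivative of the connection form \<open>\<eta>\<close>.\<close>

definition nab :: "'e \<Rightarrow> ('e \<Rightarrow> complex ^ 'd) \<Rightarrow> 'e \<Rightarrow> complex ^ 'd"
  where "nab u W x = dir_deriv W x u - imul (\<eta> x u \<odot> W x)"

text \<open>The horizontal lift of a coordinate vector.\<close>

definition L :: "'e \<Rightarrow> 'e \<Rightarrow> complex ^ 'd"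
  where "L x u = nab u s x"

lemma L_def': "L x u = dir_deriv s x u - imul (\<eta> x u \<odot> s x)"
  by (simp add: L_def nab_def)

lemma L_vert: "x \<in> U \<Longrightarrow> \<xi> \<in> lie_N v \<Longrightarrow> L x u \<bullet> imul (\<xi> \<odot> s x) = 0"
  unfolding L_def' by (rule vert)

lemma L_level: "x \<in> U \<Longrightarrow> \<xi> \<in> lie_N v \<Longrightarrow> L x u \<bullet> (\<xi> \<odot> s x) = 0"
  unfolding L_def' by (simp add: inner_diff_left level inner_vmul_vmul_imul)

lemma s_has_derivative: "x \<in> U \<Longrightarrow> (s has_derivative (\<lambda>u. dir_deriv s x u)) (at x)"
  using smooth_on_has_derivative[OF s] .

lemma linear_ds: "x \<in> U \<Longrightarrow> linear (\<lambda>u. dir_deriv s x u)"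
  using s_has_derivative has_derivative_linear by blast

lemma vmul_inner_zero_imp_zero:
  assumes "x \<in> U" "\<xi> \<in> lie_N v" "(\<xi> \<odot> s x) \<bullet> (\<xi> \<odot> s x) = 0"
  shows "\<xi> = 0"
  using assms free by simp

text \<open>Uniqueness of the vertical part, by freeness.\<close>

lemma linear_\<eta>: "x \<in> U \<Longrightarrow> linear (\<eta> x)"
proof (rule linearI)
  assume x: "x \<in> U"
  have main: "\<xi> = 0" if "\<xi> \<in> lie_N v" "\<And>\<zeta>. \<zeta> \<in> lie_N v \<Longrightarrow> imul (\<xi> \<odot> s x) \<bullet> imul (\<zeta> \<odot> s x) = 0" for \<xi>
    using vmul_inner_zero_imp_zero[OF x that(1)] that(2)[OF that(1)] by (simp add: inner_imul_imul)
  have rel: "imul (\<eta> x u \<odot> s x) \<bullet> imul (\<zeta> \<odot> s x) = dir_deriv s x u \<bullet> imul (\<zeta> \<odot> s x)"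
    if "\<zeta> \<in> lie_N v" for u \<zeta>
    using vert[OF x that] by (simp add: inner_diff_left)
  fix u w
  have "\<eta> x (u + w) - (\<eta> x u + \<eta> x w) = 0"
    by (rule main)
       (use x in \<open>auto simp: rel linear_add[OF linear_ds] vmul.diff_left vmul.add_left imul_linear_simps
         inner_diff_left inner_add_left intro!: subspace_diff subspace_add subspace_lie_N \<eta>_in\<close>)
  then show "\<eta> x (u + w) = \<eta> x u + \<eta> x w" by simp
  fix r :: real
  have "\<eta> x (r *\<^sub>R u) - r *\<^sub>R \<eta> x u = 0"
    by (rule main)
       (use x in \<open>auto simp: rel linear_scale[OF linear_ds] vmul.diff_left vmul.scaleR_left imul_linear_simps
         inner_diff_left intro!: subspace_diff subspace_scale subspace_lie_N \<eta>_in\<close>)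
  then show "\<eta> x (r *\<^sub>R u) = r *\<^sub>R \<eta> x u" by simp
qed

lemma linear_L: "x \<in> U \<Longrightarrow> linear (L x)"
  unfolding L_def'
  by (rule linearI)
     (simp_all add: linear_add[OF linear_ds] linear_add[OF linear_\<eta>] vmul.add_left imul_linear_simps
       linear_scale[OF linear_ds] linear_scale[OF linear_\<eta>] vmul.scaleR_left imul_linear_simps algebra_simps)

lemma inj_L: "x \<in> U \<Longrightarrow> inj (L x)"
  using immersion linear_injective_0[OF linear_L] unfolding L_def' by simp

text \<open>Both the normal and the vertical vectors are orthogonal to the range of \<open>L x\<close>, and by
  freeness they span a space of dimension \<open>2 dim (lie_N v)\<close>, which by \<open>dims\<close> is already the
  dimension of the orthogonal complement.\<close>

lemma range_L_orthogonal:
  assumes x: "x \<in> U" and n: "\<And>u. n \<bullet> L x u = 0"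
  obtains \<beta> \<beta>' where "\<beta> \<in> lie_N v" "\<beta>' \<in> lie_N v" "n = \<beta> \<odot> s x + imul (\<beta>' \<odot> s x)"
proof -
  let ?f = "\<lambda>(\<beta>, \<beta>'). \<beta> \<odot> s x + imul (\<beta>' \<odot> s x)"
  let ?A = "lie_N v \<times> lie_N v"
  let ?P = "{n. \<forall>y\<in>range (L x). orthogonal y n}"
  have subA: "subspace ?A" by (intro subspace_Times subspace_lie_N)
  have linf: "linear ?f"
    by (rule linearI)
       (auto simp: vmul.add_left imul_linear_simps vmul.scaleR_left imul_linear_simps scaleR_add_right)
  have injf: "inj_on ?f ?A"
    unfolding linear_injective_on_subspace_0[OF linf subA]
  proof (intro ballI impI)
    fix q assume q: "q \<in> ?A" "?f q = 0"
    obtain \<beta> \<beta>' where qb: "q = (\<beta>, \<beta>')" by (cases q)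
    have b: "\<beta> \<in> lie_N v" "\<beta>' \<in> lie_N v" "\<beta> \<odot> s x + imul (\<beta>' \<odot> s x) = 0"
      using q by (auto simp: qb)
    have "(\<beta> \<odot> s x + imul (\<beta>' \<odot> s x)) \<bullet> (\<beta> \<odot> s x) = (\<beta> \<odot> s x) \<bullet> (\<beta> \<odot> s x)"
      "(\<beta> \<odot> s x + imul (\<beta>' \<odot> s x)) \<bullet> imul (\<beta>' \<odot> s x) = (\<beta>' \<odot> s x) \<bullet> (\<beta>' \<odot> s x)"
      by (simp_all add: inner_add_left inner_vmul_vmul_imul inner_imul_imul)
    then show "q = 0" using b vmul_inner_zero_imp_zero[OF x] by (simp add: qb zero_prod_def)
  qed
  have "subspace (range (L x))" using linear_subspace_image[OF linear_L[OF x]] by simp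
  then have "dim {y \<in> UNIV. \<forall>w\<in>range (L x). orthogonal w y} + dim (range (L x)) = dim (UNIV :: (complex ^ 'd) set)"
    by (intro dim_subspace_orthogonal_to_vectors) auto
  moreover have "dim (range (L x)) = DIM('e)"
    using dim_image_eq[OF linear_L[OF x], of UNIV] inj_L[OF x] by simp
  ultimately have "dim ?P + DIM('e) = 2 * CARD('d)" by (simp add: mult.commute)
  moreover have "dim (?f ` ?A) = 2 * dim (lie_N v)"
    using dim_image_eq[OF linf, of ?A] injf dim_Times[OF subspace_lie_N[of v] subspace_lie_N[of v]]
      span_eq_iff[THEN iffD2, OF subA] by simp
  ultimately have "dim ?P \<le> dim (?f ` ?A)" using dims by linarith
  moreover have "?f ` ?A \<subseteq> ?P"
    using L_vert[OF x] L_level[OF x] by (auto simp: orthogonal_def inner_add_right)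
  moreover have "subspace (?f ` ?A)" by (rule linear_subspace_image[OF linf subA])
  moreover have "subspace ?P" by (rule subspace_orthogonal_to_vectors)
  ultimately have fP: "?f ` ?A = ?P" by (intro subspace_dim_equal)
  have "n \<in> ?P" using n by (auto simp: orthogonal_def inner_commute)
  then obtain q where q: "q \<in> ?A" "n = ?f q" unfolding fP[symmetric] by blast
  then show ?thesis using that[of "fst q" "snd q"] by (simp add: mem_Times_iff case_prod_beta)
qed

text \<open>Multiplication by \<open>i\<close> exchanges normal and vertical vectors, so it preserves their common
  orthogonal complement, the range of \<open>L x\<close>.\<close>

lemma range_L_imul:
  assumes x: "x \<in> U"
  obtains w where "L x w = imul (L x u)"
proof -
  have sub: "subspace (range (L x))" using linear_subspace_image[OF linear_L[OF x]] by simp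
  obtain y z where yz: "y \<in> span (range (L x))" "\<And>w. w \<in> span (range (L x)) \<Longrightarrow> orthogonal z w"
    "imul (L x u) = y + z" using orthogonal_subspace_decomp_exists by metis
  have "z \<bullet> L x w = 0" for w using yz(2)[of "L x w"] by (simp add: span_base orthogonal_def)
  then obtain \<beta> \<beta>' where b: "\<beta> \<in> lie_N v" "\<beta>' \<in> lie_N v" "z = \<beta> \<odot> s x + imul (\<beta>' \<odot> s x)"
    using range_L_orthogonal[OF x, of z] by blast
  have "imul (L x u) \<bullet> z = 0"
    unfolding b(3) using L_vert[OF x b(1), of u] L_level[OF x b(2), of u]
    by (simp add: inner_add_right inner_imul_imul inner_imul_left)
  moreover have "y \<bullet> z = 0" using yz(2)[OF yz(1)] by (simp add: orthogonal_def inner_commute)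
  ultimately have "z \<bullet> z = 0" using yz(3) by (simp add: inner_add_left)
  then have "imul (L x u) \<in> range (L x)" using yz sub by (simp add: span_eq_iff[THEN iffD2])
  then show ?thesis using that by (metis rangeE)
qed

lemma smooth_vmul: "smooth_on U a \<Longrightarrow> smooth_on U W \<Longrightarrow> smooth_on U (\<lambda>x. a x \<odot> W x)"
  using smooth_on_bilinear[OF bounded_bilinear_vmul U] .

lemma smooth_inner:
  fixes V W :: "'e \<Rightarrow> 'f::euclidean_space"
  shows "smooth_on U V \<Longrightarrow> smooth_on U W \<Longrightarrow> smooth_on U (\<lambda>x. V x \<bullet> W x)"
  using smooth_on_bilinear[OF bounded_bilinear_inner U] .

lemma smooth_scaleR:
  fixes W :: "'e \<Rightarrow> 'f::euclidean_space"
  shows "smooth_on U r \<Longrightarrow> smooth_on U W \<Longrightarrow> smooth_on U (\<lambda>x. r x *\<^sub>R W x)"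
  using smooth_on_bilinear[OF bounded_bilinear_scaleR U] .

lemma smooth_imul: "smooth_on U W \<Longrightarrow> smooth_on U (\<lambda>x. imul (W x))"
  using smooth_on_linear[OF U bounded_linear_imul] .

text \<open>The equations for \<open>\<eta> x u\<close> are orthogonality to a basis of vertical vectors, together with
  \<open>proj_pi v t = 0\<close>, which confines the unknown to \<open>lie_N v\<close>.\<close>

lemma smooth_\<eta>: "smooth_on U (\<lambda>x. \<eta> x u)"
proof -
  obtain B where B: "B \<subseteq> lie_N v" "independent B" "lie_N v \<subseteq> span B"
    using basis_exists[of "lie_N v"] by metis
  have fin: "finite B" using B(2) by (rule independent_imp_finite)
  let ?B = "\<lambda>x t. ((\<Sum>b\<in>B. ((t \<odot> s x) \<bullet> (b \<odot> s x)) *\<^sub>R b), proj_pi v t)"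
  let ?f = "\<lambda>x. ((\<Sum>b\<in>B. (dir_deriv s x u \<bullet> imul (b \<odot> s x)) *\<^sub>R b), 0 :: real ^ 'n)"
  have pair: "bounded_linear (\<lambda>t :: real ^ 'd. (t, 0 :: real ^ 'n))"
    by (intro bounded_linear_Pair bounded_linear_ident bounded_linear_zero)
  show ?thesis
  proof (rule smooth_on_linear_solve[OF U, of ?B ?f])
    fix x assume x: "x \<in> U"
    show lin: "linear (?B x)"
      by (rule linearI)
         (simp_all add: vmul.add_left vmul.scaleR_left inner_add_left scaleR_left_distrib sum.distrib
           scaleR_sum_right linear_add[OF linear_proj_pi] linear_scale[OF linear_proj_pi])
    show "inj (?B x)"
      unfolding linear_injective_0[OF lin]
    proof (intro allI impI)
      fix t assume t: "?B x t = 0"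
      then have tN: "t \<in> lie_N v" by (simp add: lie_N_def zero_prod_def)
      have sum0: "(\<Sum>b\<in>B. ((t \<odot> s x) \<bullet> (b \<odot> s x)) *\<^sub>R b) = 0" using t by (simp add: zero_prod_def)
      have z: "(t \<odot> s x) \<bullet> (b \<odot> s x) = 0" if "b \<in> B" for b
        by (rule independentD[OF B(2) fin order.refl _ that, of "\<lambda>b. (t \<odot> s x) \<bullet> (b \<odot> s x)"])
         (rule sum0)
      have "(t \<odot> s x) \<bullet> (\<zeta> \<odot> s x) = 0" if "\<zeta> \<in> span B" for \<zeta>
        using that
        by (induction rule: span_induct_alt)
           (simp_all add: z vmul.zero_left vmul.add_left vmul.scaleR_left inner_add_right)
      then show "t = 0" using vmul_inner_zero_imp_zero[OF x tN] tN B(3) by blast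
    qed
    have "(dir_deriv s x u \<bullet> imul (b \<odot> s x)) = (\<eta> x u \<odot> s x) \<bullet> (b \<odot> s x)" if "b \<in> B" for b
      using vert[OF x, of b u] B(1) that by (auto simp: inner_diff_left inner_imul_imul)
    then show "?B x (\<eta> x u) = ?f x" using \<eta>_in[OF x, of u] by (simp add: lie_N_def)
  next
    fix t
    have "smooth_on U (\<lambda>x. ((\<Sum>b\<in>B. ((t \<odot> s x) \<bullet> (b \<odot> s x)) *\<^sub>R b), 0 :: real ^ 'n) + (0, proj_pi v t))"
      by (intro smooth_on_add U smooth_on_const smooth_on_linear[OF U pair] smooth_on_sum smooth_scaleR
          smooth_inner smooth_vmul s)
    then show "smooth_on U (\<lambda>x. ?B x t)" by simp
    show "smooth_on U ?f"
      by (intro U smooth_on_const smooth_on_linear[OF U pair] smooth_on_sum smooth_scaleR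
          smooth_inner smooth_vmul smooth_imul smooth_on_dir_deriv s)
  qed
qed

lemma smooth_nab: "smooth_on U W \<Longrightarrow> smooth_on U (nab u W)"
  unfolding nab_def
  by (intro smooth_on_diff U smooth_on_dir_deriv smooth_imul smooth_vmul smooth_\<eta>)

lemma smooth_L: "smooth_on U (\<lambda>x. L x u)"
  unfolding L_def by (rule smooth_nab[OF s])

lemma dir_deriv_inner:
  fixes V W :: "'e \<Rightarrow> 'f::euclidean_space"
  assumes "smooth_on U V" "smooth_on U W" "x \<in> U"
  shows "dir_deriv (\<lambda>y. V y \<bullet> W y) x u = V x \<bullet> dir_deriv W x u + dir_deriv V x u \<bullet> W x"
  by (rule dir_deriv_at[OF has_derivative_inner]) (use assms smooth_on_has_derivative in auto)

text \<open>The connection form acts by skew-adjoint maps, so the covariant derivative is metric.\<close>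

lemma dir_deriv_inner_nab:
  assumes "smooth_on U V" "smooth_on U W" "x \<in> U"
  shows "dir_deriv (\<lambda>y. V y \<bullet> W y) x u = V x \<bullet> nab u W x + nab u V x \<bullet> W x"
  unfolding dir_deriv_inner[OF assms] nab_def
  by (simp add: inner_diff_left inner_diff_right inner_imul_left inner_vmul_left vmul_imul)

lemma dir_deriv_imul_vmul:
  assumes "smooth_on U a" "smooth_on U W" "x \<in> U"
  shows "dir_deriv (\<lambda>y. imul (a y \<odot> W y)) x u = imul (a x \<odot> dir_deriv W x u + dir_deriv a x u \<odot> W x)"
  by (rule dir_deriv_at[OF bounded_linear.has_derivative[OF bounded_linear_imul vmul.FDERIV]])
     (use assms smooth_on_has_derivative in auto)

lemma dir_deriv_diff:
  assumes "smooth_on U V" "smooth_on U W" "x \<in> U"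
  shows "dir_deriv (\<lambda>y. V y - W y) x u = dir_deriv V x u - dir_deriv W x u"
  by (rule dir_deriv_at[OF has_derivative_diff]) (use assms smooth_on_has_derivative in auto)

text \<open>The exterior derivative of \<open>\<eta>\<close>; the structure group being abelian, this is its curvature.\<close>

definition curv :: "'e \<Rightarrow> 'e \<Rightarrow> 'e \<Rightarrow> real ^ 'd"
  where "curv x u w = dir_deriv (\<lambda>y. \<eta> y w) x u - dir_deriv (\<lambda>y. \<eta> y u) x w"

text \<open>Second derivatives commute, and so do the multiplications \<open>\<odot>\<close>; only the derivatives of
  \<open>\<eta>\<close> remain.\<close>

lemma nab_commutator:
  assumes W: "smooth_on U W" and x: "x \<in> U"
  shows "nab u (nab w W) x - nab w (nab u W) x = - imul (curv x u w \<odot> W x)"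
proof -
  have *: "nab u (nab w W) x = dir_deriv (\<lambda>y. dir_deriv W y w) x u
     - imul (\<eta> x w \<odot> dir_deriv W x u + dir_deriv (\<lambda>y. \<eta> y w) x u \<odot> W x)
     - imul (\<eta> x u \<odot> (dir_deriv W x w - imul (\<eta> x w \<odot> W x)))" for u w
  proof -
    have "dir_deriv (nab w W) x u = dir_deriv (\<lambda>y. dir_deriv W y w) x u - dir_deriv (\<lambda>y. imul (\<eta> y w \<odot> W y)) x u"
      unfolding nab_def
      by (rule dir_deriv_diff) (intro smooth_on_dir_deriv smooth_imul smooth_vmul smooth_\<eta> W x)+
    then show ?thesis
      unfolding nab_def[of u] dir_deriv_imul_vmul[OF smooth_\<eta> W x] by (simp add: nab_def)
  qed
  have "dir_deriv (\<lambda>y. dir_deriv W y w) x u = dir_deriv (\<lambda>y. dir_deriv W y u) x w"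
    by (rule dir_deriv_commute[OF U x W])
  then show ?thesis
    unfolding * curv_def
    by (simp add: vmul.diff_left vmul.diff_right vmul_imul imul_imul imul_linear_simps
        vmul_commute[of "\<eta> x u" "\<eta> x w"])
qed

text \<open>Since \<open>L y w\<close> is the covariant derivative of \<open>s\<close>, this is the commutator applied to \<open>s\<close>:
  the torsion is vertical.\<close>

lemma nab_L_commute: "x \<in> U \<Longrightarrow> nab u (\<lambda>y. L y w) x - nab w (\<lambda>y. L y u) x = - imul (curv x u w \<odot> s x)"
  using nab_commutator[OF s, of x u w] by (simp add: L_def[abs_def])

lemma curv_in: "x \<in> U \<Longrightarrow> curv x u w \<in> lie_N v"
proof -
  assume x: "x \<in> U"
  have "dir_deriv (\<lambda>y. \<eta> y w) x u \<in> lie_N v" for u w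
  proof -
    have bl: "bounded_linear (proj_pi v)" using linear_proj_pi by (rule linear_conv_bounded_linear[THEN iffD1])
    have "dir_deriv (\<lambda>y. proj_pi v (\<eta> y w)) x u = proj_pi v (dir_deriv (\<lambda>y. \<eta> y w) x u)"
      by (rule dir_deriv_at[OF bounded_linear.has_derivative[OF bl]])
         (rule smooth_on_has_derivative[OF smooth_\<eta> x])
    moreover have "dir_deriv (\<lambda>y. proj_pi v (\<eta> y w)) x u = dir_deriv (\<lambda>y. 0) x u"
      using \<eta>_in by (intro dir_deriv_cong[OF U x]) (simp add: lie_N_def)
    ultimately show ?thesis by (simp add: lie_N_def)
  qed
  then show ?thesis unfolding curv_def by (intro subspace_diff subspace_lie_N)
qed

lemma dir_deriv_g:
  assumes x: "x \<in> U"
  shows "dir_deriv (\<lambda>y. g y w a) x u = L x w \<bullet> nab u (\<lambda>y. L y a) x + nab u (\<lambda>y. L y w) x \<bullet> L x a"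
proof -
  have "dir_deriv (\<lambda>y. g y w a) x u = dir_deriv (\<lambda>y. L y w \<bullet> L y a) x u"
    using g by (intro dir_deriv_cong[OF U x]) (simp add: L_def')
  then show ?thesis by (simp add: dir_deriv_inner_nab[OF smooth_L smooth_L x])
qed

text \<open>The Koszul expression for the quotient metric. Horizontal vectors do not see the vertical
  torsion, so the usual cancellation leaves a single term.\<close>

lemma koszul:
  assumes x: "x \<in> U"
  shows "(dir_deriv (\<lambda>y. g y w a) x u + dir_deriv (\<lambda>y. g y u a) x w - dir_deriv (\<lambda>y. g y u w) x a) / 2
    = nab u (\<lambda>y. L y w) x \<bullet> L x a"
proof -
  have t: "nab u (\<lambda>y. L y w) x \<bullet> L x a = nab w (\<lambda>y. L y u) x \<bullet> L x a" for u w a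
  proof -
    have "(nab u (\<lambda>y. L y w) x - nab w (\<lambda>y. L y u) x) \<bullet> L x a = 0"
      unfolding nab_L_commute[OF x] using L_vert[OF x curv_in[OF x]] by (simp add: inner_commute)
    then show ?thesis by (simp add: inner_diff_left)
  qed
  show ?thesis
    unfolding dir_deriv_g[OF x] using t[of u a w] t[of w a u] t[of w u a]
    by (simp add: inner_commute)
qed

definition \<Gamma> :: "'e \<Rightarrow> 'e \<Rightarrow> 'e \<Rightarrow> 'e"
  where "\<Gamma> x u w = christoffel g x u w"

lemma L_eqI:
  assumes x: "x \<in> U" and eq: "\<And>a. L x c \<bullet> L x a = L x c' \<bullet> L x a"
  shows "c = c'"
proof -
  have "L x (c - c') \<bullet> L x (c - c') = 0"
    using eq[of "c - c'"] by (simp add: linear_diff[OF linear_L[OF x]] inner_diff_left)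
  then have "c - c' = 0" using inj_L[OF x] linear_injective_0[OF linear_L[OF x]] by auto
  then show ?thesis by simp
qed

lemma L_\<Gamma>:
  assumes x: "x \<in> U"
  shows "L x (\<Gamma> x u w) \<bullet> L x a = nab u (\<lambda>y. L y w) x \<bullet> L x a"
proof -
  have "\<exists>!c. \<forall>a. g x c a = (dir_deriv (\<lambda>y. g y w a) x u + dir_deriv (\<lambda>y. g y u a) x w
         - dir_deriv (\<lambda>y. g y u w) x a) / 2"
    unfolding koszul[OF x] g[OF x] L_def'[symmetric]
  proof (rule ex_ex1I)
    have sub: "subspace (range (L x))" using linear_subspace_image[OF linear_L[OF x]] by simp
    obtain y z where yz: "y \<in> span (range (L x))" "\<And>w. w \<in> span (range (L x)) \<Longrightarrow> orthogonal z w"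
      "nab u (\<lambda>y. L y w) x = y + z" using orthogonal_subspace_decomp_exists by metis
    obtain c where "y = L x c" using yz(1) sub by (auto simp: span_eq_iff[THEN iffD2])
    moreover have "z \<bullet> L x a = 0" for a using yz(2)[of "L x a"] by (simp add: span_base orthogonal_def)
    ultimately show "\<exists>c. \<forall>a. L x c \<bullet> L x a = nab u (\<lambda>y. L y w) x \<bullet> L x a"
      using yz(3) by (auto simp: inner_add_left)
    show "c = c'" if "\<forall>a. L x c \<bullet> L x a = nab u (\<lambda>y. L y w) x \<bullet> L x a"
      "\<forall>a. L x c' \<bullet> L x a = nab u (\<lambda>y. L y w) x \<bullet> L x a" for c c'
      using that by (intro L_eqI[OF x]) simp
  qed
  from theI'[OF this] have "g x (\<Gamma> x u w) a = nab u (\<lambda>y. L y w) x \<bullet> L x a"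
    unfolding \<Gamma>_def christoffel_def koszul[OF x] by blast
  then show ?thesis by (simp add: g[OF x] L_def')
qed

text \<open>The Christoffel symbols solve the linear system with the Gram matrix of the metric.\<close>

lemma smooth_\<Gamma>: "smooth_on U (\<lambda>x. \<Gamma> x u w)"
proof (rule smooth_on_linear_solve[OF U])
  let ?B = "\<lambda>x c. \<Sum>a\<in>Basis. (L x c \<bullet> L x a) *\<^sub>R a"
  fix x assume x: "x \<in> U"
  show lin: "linear (?B x)"
    by (rule linearI)
       (auto simp: linear_add[OF linear_L[OF x]] linear_scale[OF linear_L[OF x]] inner_add_left
         scaleR_left_distrib sum.distrib scaleR_sum_right)
  show "inj (?B x)"
    unfolding linear_injective_0[OF lin]
  proof (intro allI impI)
    fix c assume c: "?B x c = 0"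
    have "L x c \<bullet> L x a = 0" if "a \<in> Basis" for a
      using arg_cong[OF c, of "\<lambda>t. t \<bullet> a"] that by (simp add: inner_sum_left_Basis)
    then have "L x c \<bullet> L x a = L x 0 \<bullet> L x a" for a
      using linear_basis_expansion[OF linear_L[OF x], of a]
      by (simp add: inner_sum_right linear_0[OF linear_L[OF x]])
    then show "c = 0" by (rule L_eqI[OF x])
  qed
  show "?B x (\<Gamma> x u w) = (\<Sum>a\<in>Basis. (nab u (\<lambda>y. L y w) x \<bullet> L x a) *\<^sub>R a)"
    by (simp add: L_\<Gamma>[OF x])
next
  show "smooth_on U (\<lambda>x. \<Sum>a\<in>Basis. (L x t \<bullet> L x a) *\<^sub>R a)" for t
    by (intro smooth_on_sum U smooth_scaleR smooth_inner smooth_L smooth_on_const)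
  show "smooth_on U (\<lambda>x. \<Sum>a\<in>Basis. (nab u (\<lambda>y. L y w) x \<bullet> L x a) *\<^sub>R a)"
    by (intro smooth_on_sum U smooth_scaleR smooth_inner smooth_L smooth_nab smooth_on_const)
qed

text \<open>The part of the covariant derivative orthogonal to the horizontal space.\<close>

definition \<nu> :: "'e \<Rightarrow> 'e \<Rightarrow> 'e \<Rightarrow> complex ^ 'd"
  where "\<nu> x u w = nab u (\<lambda>y. L y w) x - L x (\<Gamma> x u w)"

lemma \<nu>_L: "x \<in> U \<Longrightarrow> \<nu> x u w \<bullet> L x a = 0"
  by (simp add: \<nu>_def inner_diff_left L_\<Gamma>)

lemma nab_L_product:
  assumes c: "smooth_on U c" and x: "x \<in> U"
  shows "nab u (\<lambda>y. L y (c y)) x = nab u (\<lambda>y. L y (c x)) x + L x (dir_deriv c x u)"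
proof -
  have h: "((\<lambda>y. \<Sum>b\<in>Basis. (c y \<bullet> b) *\<^sub>R L y b) has_derivative
      (\<lambda>u. \<Sum>b\<in>Basis. ((c x \<bullet> b) *\<^sub>R dir_deriv (\<lambda>y. L y b) x u + (dir_deriv c x u \<bullet> b) *\<^sub>R L x b))) (at x)"
    by (intro has_derivative_sum has_derivative_scaleR has_derivative_inner_left
        smooth_on_has_derivative[OF c x] smooth_on_has_derivative[OF smooth_L x])
  have h0: "((\<lambda>y. \<Sum>b\<in>Basis. (c x \<bullet> b) *\<^sub>R L y b) has_derivative
      (\<lambda>u. \<Sum>b\<in>Basis. (c x \<bullet> b) *\<^sub>R dir_deriv (\<lambda>y. L y b) x u)) (at x)"
    by (intro has_derivative_sum has_derivative_scaleR_right smooth_on_has_derivative[OF smooth_L x])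
  have "dir_deriv (\<lambda>y. L y (c y)) x u = (\<Sum>b\<in>Basis. ((c x \<bullet> b) *\<^sub>R dir_deriv (\<lambda>y. L y b) x u + (dir_deriv c x u \<bullet> b) *\<^sub>R L x b))"
    using dir_deriv_cong[OF U x, of "\<lambda>y. L y (c y)" "\<lambda>y. \<Sum>b\<in>Basis. (c y \<bullet> b) *\<^sub>R L y b" u]
      linear_basis_expansion[OF linear_L] dir_deriv_at[OF h] by metis
  also have "\<dots> = dir_deriv (\<lambda>y. L y (c x)) x u + L x (dir_deriv c x u)"
    using dir_deriv_cong[OF U x, of "\<lambda>y. L y (c x)" "\<lambda>y. \<Sum>b\<in>Basis. (c x \<bullet> b) *\<^sub>R L y b" u]
      linear_basis_expansion[OF linear_L, of _ "c x"] dir_deriv_at[OF h0]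
      linear_basis_expansion[OF linear_L[OF x], of "dir_deriv c x u"]
    by (simp add: sum.distrib)
  finally show ?thesis by (simp add: nab_def)
qed

lemma smooth_L_comp:
  assumes c: "smooth_on U c"
  shows "smooth_on U (\<lambda>y. L y (c y))"
proof (rule smooth_on_cong[OF U])
  show "smooth_on U (\<lambda>y. \<Sum>b\<in>Basis. (c y \<bullet> b) *\<^sub>R L y b)"
    by (intro smooth_on_sum U smooth_scaleR smooth_inner smooth_L c smooth_on_const)
qed (use linear_basis_expansion[OF linear_L] in metis)

text \<open>Differentiate the identity \<open>L_\<Gamma>\<close> in direction \<open>u\<close>. Only the normal and vertical parts \<open>\<nu>\<close>
  of the first derivatives survive besides the second covariant derivative.\<close>

lemma second_covariant_derivative:
  assumes x: "x \<in> U"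
  shows "L x (dir_deriv (\<lambda>y. \<Gamma> y v' w) x u + \<Gamma> x u (\<Gamma> x v' w)) \<bullet> L x a
    = nab u (nab v' (\<lambda>y. L y w)) x \<bullet> L x a + \<nu> x v' w \<bullet> \<nu> x u a"
proof -
  let ?G = "\<lambda>y. \<Gamma> y v' w"
  have "dir_deriv (\<lambda>y. L y (?G y) \<bullet> L y a) x u = dir_deriv (\<lambda>y. nab v' (\<lambda>y. L y w) y \<bullet> L y a) x u"
    by (rule dir_deriv_cong[OF U x]) (rule L_\<Gamma>)
  then have "L x (?G x) \<bullet> nab u (\<lambda>y. L y a) x + nab u (\<lambda>y. L y (?G y)) x \<bullet> L x a
     = nab v' (\<lambda>y. L y w) x \<bullet> nab u (\<lambda>y. L y a) x + nab u (nab v' (\<lambda>y. L y w)) x \<bullet> L x a"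
    by (simp add: dir_deriv_inner_nab[OF smooth_L_comp[OF smooth_\<Gamma>] smooth_L x]
        dir_deriv_inner_nab[OF smooth_nab[OF smooth_L] smooth_L x])
  moreover have "nab u (\<lambda>y. L y (?G y)) x \<bullet> L x a = L x (\<Gamma> x u (?G x)) \<bullet> L x a + L x (dir_deriv ?G x u) \<bullet> L x a"
    by (simp add: nab_L_product[OF smooth_\<Gamma> x] inner_add_left L_\<Gamma>[OF x])
  moreover have "\<nu> x v' w \<bullet> \<nu> x u a = \<nu> x v' w \<bullet> nab u (\<lambda>y. L y a) x"
    using \<nu>_L[OF x] by (simp add: \<nu>_def[of x u a] inner_diff_right)
  ultimately show ?thesis
    by (simp add: \<nu>_def[of x v' w] linear_add[OF linear_L[OF x]] inner_add_left inner_diff_left algebra_simps)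
qed

text \<open>Gauss equation and O'Neill formula in one: the first term is the curvature of the torus
  bundle, and \<open>\<nu>\<close> contains the second fundamental form of the level set (its normal part)
  together with the O'Neill tensor (its vertical part).\<close>

lemma riemann_formula:
  assumes x: "x \<in> U"
  shows "riemann_tensor g x u v' w a = - (imul (curv x u v' \<odot> L x w) \<bullet> L x a)
    + \<nu> x v' w \<bullet> \<nu> x u a - \<nu> x u w \<bullet> \<nu> x v' a"
proof -
  have "riemann_tensor g x u v' w a = L x (curvature_op g x u v' w) \<bullet> L x a"
    by (simp add: riemann_tensor_def g[OF x] L_def')
  also have "\<dots> = (nab u (nab v' (\<lambda>y. L y w)) x - nab v' (nab u (\<lambda>y. L y w)) x) \<bullet> L x a
      + \<nu> x v' w \<bullet> \<nu> x u a - \<nu> x u w \<bullet> \<nu> x v' a"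
    using second_covariant_derivative[OF x, of v' w u a] second_covariant_derivative[OF x, of u w v' a]
    unfolding curvature_op_def linear_diff[OF linear_L[OF x]] \<Gamma>_def[symmetric]
    by (simp add: inner_diff_left)
  finally show ?thesis by (simp add: nab_commutator[OF smooth_L x])
qed

lemma nab_vmul_s:
  assumes x: "x \<in> U"
  shows "nab u (\<lambda>y. \<xi> \<odot> s y) x = \<xi> \<odot> L x u"
    and "nab u (\<lambda>y. imul (\<xi> \<odot> s y)) x = imul (\<xi> \<odot> L x u)"
proof -
  have 1: "dir_deriv (\<lambda>y. \<xi> \<odot> s y) x u = \<xi> \<odot> dir_deriv s x u"
    by (rule dir_deriv_at[OF bounded_linear.has_derivative[OF vmul.bounded_linear_right s_has_derivative[OF x]]])
  show "nab u (\<lambda>y. \<xi> \<odot> s y) x = \<xi> \<odot> L x u"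
    unfolding nab_def L_def' 1 by (simp add: vmul.diff_right vmul_imul vmul_commute[of \<xi>])
  have 2: "dir_deriv (\<lambda>y. imul (\<xi> \<odot> s y)) x u = imul (\<xi> \<odot> dir_deriv s x u)"
    by (rule dir_deriv_at[OF bounded_linear.has_derivative[OF bounded_linear_imul
          bounded_linear.has_derivative[OF vmul.bounded_linear_right s_has_derivative[OF x]]]])
  show "nab u (\<lambda>y. imul (\<xi> \<odot> s y)) x = imul (\<xi> \<odot> L x u)"
    unfolding nab_def L_def' 2 by (simp add: vmul.diff_right vmul_imul imul_linear_simps vmul_commute[of \<xi>])
qed

text \<open>Differentiate the orthogonality of \<open>L y w\<close> to \<open>\<xi> \<odot> s\<close> and to \<open>i(\<xi> \<odot> s)\<close>, using
  \<open>nab_vmul_s\<close>.\<close>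

lemma \<nu>_inner:
  assumes x: "x \<in> U" and \<xi>: "\<xi> \<in> lie_N v"
  shows "\<nu> x u w \<bullet> (\<xi> \<odot> s x) = - (L x w \<bullet> (\<xi> \<odot> L x u))"
    and "\<nu> x u w \<bullet> imul (\<xi> \<odot> s x) = - (L x w \<bullet> imul (\<xi> \<odot> L x u))"
proof -
  have sm: "smooth_on U (\<lambda>y. \<xi> \<odot> s y)" "smooth_on U (\<lambda>y. imul (\<xi> \<odot> s y))"
    by (intro smooth_imul smooth_vmul smooth_on_const s)+
  have "dir_deriv (\<lambda>y. L y w \<bullet> (\<xi> \<odot> s y)) x u = dir_deriv (\<lambda>y. 0) x u"
    by (rule dir_deriv_cong[OF U x]) (rule L_level[OF _ \<xi>])
  then have "nab u (\<lambda>y. L y w) x \<bullet> (\<xi> \<odot> s x) = - (L x w \<bullet> (\<xi> \<odot> L x u))"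
    by (simp add: dir_deriv_inner_nab[OF smooth_L sm(1) x] nab_vmul_s[OF x])
  then show "\<nu> x u w \<bullet> (\<xi> \<odot> s x) = - (L x w \<bullet> (\<xi> \<odot> L x u))"
    by (simp add: \<nu>_def inner_diff_left L_level[OF x \<xi>])
  have "dir_deriv (\<lambda>y. L y w \<bullet> imul (\<xi> \<odot> s y)) x u = dir_deriv (\<lambda>y. 0) x u"
    by (rule dir_deriv_cong[OF U x]) (rule L_vert[OF _ \<xi>])
  then have "nab u (\<lambda>y. L y w) x \<bullet> imul (\<xi> \<odot> s x) = - (L x w \<bullet> imul (\<xi> \<odot> L x u))"
    by (simp add: dir_deriv_inner_nab[OF smooth_L sm(2) x] nab_vmul_s[OF x])
  then show "\<nu> x u w \<bullet> imul (\<xi> \<odot> s x) = - (L x w \<bullet> imul (\<xi> \<odot> L x u))"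
    by (simp add: \<nu>_def inner_diff_left L_vert[OF x \<xi>])
qed

text \<open>The pairings in \<open>\<nu>_inner\<close> determine \<open>\<nu>\<close>, which lies in the span of the normal and
  vertical vectors.\<close>

lemma \<nu>_eqI:
  assumes x: "x \<in> U" and b: "\<beta> \<in> lie_N v" "\<beta>' \<in> lie_N v"
    and 1: "\<And>\<xi>. \<xi> \<in> lie_N v \<Longrightarrow> (\<beta> \<odot> s x) \<bullet> (\<xi> \<odot> s x) = - (L x w \<bullet> (\<xi> \<odot> L x u))"
    and 2: "\<And>\<xi>. \<xi> \<in> lie_N v \<Longrightarrow> (\<beta>' \<odot> s x) \<bullet> (\<xi> \<odot> s x) = - (L x w \<bullet> imul (\<xi> \<odot> L x u))"
  shows "\<nu> x u w = \<beta> \<odot> s x + imul (\<beta>' \<odot> s x)"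
proof -
  obtain c c' where c: "c \<in> lie_N v" "c' \<in> lie_N v" "\<nu> x u w = c \<odot> s x + imul (c' \<odot> s x)"
    using range_L_orthogonal[OF x \<nu>_L[OF x]] by blast
  have in1: "(\<beta> - c) \<in> lie_N v" "(\<beta>' - c') \<in> lie_N v"
    using b c by (auto intro: subspace_diff subspace_lie_N)
  have cc: "(c \<odot> s x) \<bullet> (\<xi> \<odot> s x) = - (L x w \<bullet> (\<xi> \<odot> L x u))"
    "(c' \<odot> s x) \<bullet> (\<xi> \<odot> s x) = - (L x w \<bullet> imul (\<xi> \<odot> L x u))" if "\<xi> \<in> lie_N v" for \<xi>
    using \<nu>_inner[OF x that, of u w] unfolding c(3)
    by (simp_all add: inner_add_left inner_vmul_vmul_imul inner_imul_imul)
  have sq: "((\<xi> - \<zeta>) \<odot> s x) \<bullet> ((\<xi> - \<zeta>) \<odot> s x)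
      = (\<xi> \<odot> s x) \<bullet> ((\<xi> - \<zeta>) \<odot> s x) - (\<zeta> \<odot> s x) \<bullet> ((\<xi> - \<zeta>) \<odot> s x)" for \<xi> \<zeta>
    by (simp add: vmul.diff_left inner_diff_left)
  have "((\<beta> - c) \<odot> s x) \<bullet> ((\<beta> - c) \<odot> s x) = 0" "((\<beta>' - c') \<odot> s x) \<bullet> ((\<beta>' - c') \<odot> s x) = 0"
    unfolding sq using 1[OF in1(1)] 2[OF in1(2)] cc(1)[OF in1(1)] cc(2)[OF in1(2)] by simp_all
  then have "\<beta> - c = 0" "\<beta>' - c' = 0" using vmul_inner_zero_imp_zero[OF x] in1 by blast+
  then show ?thesis using c by simp
qed

text \<open>With \<open>h = L x V\<close> the pairings of \<open>\<nu>_inner\<close> show that \<open>\<nu>\<close>, on the span of \<open>V\<close> and \<open>W\<close>, is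
  conjugate linear in its first and complex linear in its second argument:
  \<open>\<nu>(V,V) = \<nu>(W,W) = \<beta> \<odot> s\<close> and \<open>\<nu>(V,W) = - \<nu>(W,V) = i(\<beta> \<odot> s)\<close>. The antisymmetric part of \<open>\<nu>\<close>
  is the torsion, whence the curvature of \<open>\<eta>\<close> on \<open>(V, W)\<close> is \<open>-2 \<beta>\<close>. In \<open>riemann_formula\<close> this
  curvature contributes \<open>2 |\<beta> \<odot> s|^2\<close>, and each product of two \<open>\<nu>\<close>s contributes \<open>|\<beta> \<odot> s|^2\<close>.\<close>

lemma riemann_holomorphic:
  assumes x: "x \<in> U" and W: "L x W = imul (L x V)"
  obtains \<beta> where "\<beta> \<in> lie_N v"
    "riemann_tensor g x V W W V = 4 * ((\<beta> \<odot> s x) \<bullet> (\<beta> \<odot> s x))"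
    "\<And>\<xi>. \<xi> \<in> lie_N v \<Longrightarrow> (\<beta> \<odot> s x) \<bullet> (\<xi> \<odot> s x) = - (L x V \<bullet> (\<xi> \<odot> L x V))"
proof -
  let ?h = "L x V"
  obtain \<beta> \<beta>' where b: "\<beta> \<in> lie_N v" "\<beta>' \<in> lie_N v" "\<nu> x V V = \<beta> \<odot> s x + imul (\<beta>' \<odot> s x)"
    using range_L_orthogonal[OF x \<nu>_L[OF x]] by blast
  have 0: "0 \<in> lie_N v" by (rule subspace_0[OF subspace_lie_N])
  have B: "(\<beta> \<odot> s x) \<bullet> (\<xi> \<odot> s x) = - (?h \<bullet> (\<xi> \<odot> ?h))" if "\<xi> \<in> lie_N v" for \<xi>
    using \<nu>_inner(1)[OF x that, of V V] unfolding b(3)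
    by (simp add: inner_add_left inner_vmul_vmul_imul)
  have mb: "- \<beta> \<in> lie_N v" using b(1) by (rule subspace_neg[OF subspace_lie_N])
  have VV: "\<nu> x V V = \<beta> \<odot> s x"
    using \<nu>_eqI[OF x b(1) 0, of V V] B by (simp add: inner_vmul_imul_self vmul.zero_left)
  have VW: "\<nu> x V W = imul (\<beta> \<odot> s x)"
    using \<nu>_eqI[OF x 0 b(1), of W V] B
    by (simp add: W inner_vmul_imul_self inner_imul_imul vmul.zero_left)
  have WV: "\<nu> x W V = - imul (\<beta> \<odot> s x)"
    using \<nu>_eqI[OF x 0 mb, of V W] B
    by (simp add: W inner_vmul_imul_self vmul_imul imul_imul vmul.zero_left vmul.minus_left imul_linear_simps)
  have WW: "\<nu> x W W = \<beta> \<odot> s x"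
    using \<nu>_eqI[OF x b(1) 0, of W W] B
    by (simp add: W inner_vmul_imul_self inner_imul_imul vmul_imul imul_imul vmul.zero_left)
  have "curv x V W + 2 *\<^sub>R \<beta> = 0"
  proof (rule vmul_inner_zero_imp_zero[OF x])
    let ?c = "curv x V W + 2 *\<^sub>R \<beta>"
    show cin: "?c \<in> lie_N v"
      using curv_in[OF x] b(1) by (intro subspace_add subspace_scale subspace_lie_N)
    have "nab V (\<lambda>y. L y W) x - nab W (\<lambda>y. L y V) x
        = \<nu> x V W - \<nu> x W V + L x (\<Gamma> x V W - \<Gamma> x W V)"
      by (simp add: \<nu>_def linear_diff[OF linear_L[OF x]])
    then have "- imul (curv x V W \<odot> s x) = 2 *\<^sub>R imul (\<beta> \<odot> s x) + L x (\<Gamma> x V W - \<Gamma> x W V)"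
      unfolding nab_L_commute[OF x] VW WV by (simp add: scaleR_2)
    then have "- (imul (curv x V W \<odot> s x) \<bullet> imul (?c \<odot> s x)) = 2 * (imul (\<beta> \<odot> s x) \<bullet> imul (?c \<odot> s x))"
      using L_vert[OF x cin] by (metis (no_types, lifting) add.right_neutral inner_add_left inner_minus_left inner_scaleR_left)
    moreover have "(?c \<odot> s x) \<bullet> z = (curv x V W \<odot> s x) \<bullet> z + 2 * ((\<beta> \<odot> s x) \<bullet> z)" for z
      by (simp add: vmul.add_left vmul.scaleR_left inner_add_left)
    ultimately show "(?c \<odot> s x) \<bullet> (?c \<odot> s x) = 0"
      by (simp only: inner_imul_imul)
  qed
  then have c: "curv x V W = - (2 *\<^sub>R \<beta>)" by (simp add: eq_neg_iff_add_eq_0)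
  have "riemann_tensor g x V W W V = 4 * ((\<beta> \<odot> s x) \<bullet> (\<beta> \<odot> s x))"
    unfolding riemann_formula[OF x] VV VW WV WW W c
    using B[OF b(1)]
    by (simp add: vmul_imul imul_imul inner_imul_imul vmul.minus_left vmul.scaleR_left imul_linear_simps inner_commute)
  then show ?thesis using that b(1) B by blast
qed

end

section \<open>From Delzant's construction to charts\<close>

text \<open>The factor \<open>2 pi\<close> comes from \<open>R / Z\<close> being the circle; as \<open>lie_N v\<close> is a subspace it
  disappears in \<open>vertical_space_eq\<close>.\<close>

lemma torus_act_has_vector_derivative:
  fixes c :: "real \<Rightarrow> complex ^ 'd::finite"
  assumes c: "(c has_vector_derivative c') (at 0)"
  shows "((\<lambda>t. torus_act (t *\<^sub>R \<zeta>) (c t)) has_vector_derivative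
    c' + imul (((2 * pi) *\<^sub>R \<zeta>) \<odot> c 0)) (at 0)"
proof -
  have cj: "((\<lambda>t. c t $ j) has_vector_derivative c' $ j) (at 0)" for j
    using bounded_linear.has_vector_derivative[OF bounded_linear_vec_nth c] .
  have comp: "((\<lambda>t. cis (2 * pi * (t *\<^sub>R \<zeta>) $ j) * c t $ j) has_vector_derivative
      c' $ j + \<i> * complex_of_real (2 * pi * \<zeta> $ j) * c 0 $ j) (at 0)" for j
  proof -
    have "((\<lambda>t. cis (2 * pi * (t *\<^sub>R \<zeta>) $ j)) has_vector_derivative
        (2 * pi * \<zeta> $ j) *\<^sub>R (\<i> * cis (2 * pi * (0 *\<^sub>R \<zeta>) $ j))) (at 0)"
      by (auto simp: has_vector_derivative_def intro!: derivative_eq_intros simp: algebra_simps)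
    from has_vector_derivative_mult[OF this cj[of j]]
    show ?thesis by (simp add: algebra_simps scaleR_conv_of_real)
  qed
  have bl: "bounded_linear (\<lambda>z :: complex. axis j z :: complex ^ 'd)" for j
    by (rule linear_conv_bounded_linear[THEN iffD1], rule linearI) (auto simp: axis_def vec_eq_iff)
  have "((\<lambda>t. \<Sum>j\<in>UNIV. axis j (cis (2 * pi * (t *\<^sub>R \<zeta>) $ j) * c t $ j)) has_vector_derivative
     (\<Sum>j\<in>UNIV. axis j (c' $ j + \<i> * complex_of_real (2 * pi * \<zeta> $ j) * c 0 $ j))) (at 0)"
    by (intro has_vector_derivative_sum bounded_linear.has_vector_derivative[OF bl comp])
  moreover have ax: "(\<Sum>j\<in>UNIV. axis j (f j)) = (\<chi> j. f j)" for f :: "'d \<Rightarrow> complex"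
    by (simp add: vec_eq_iff axis_def)
  moreover have "(\<chi> j. c' $ j + \<i> * complex_of_real (2 * pi * \<zeta> $ j) * c 0 $ j)
      = c' + imul (((2 * pi) *\<^sub>R \<zeta>) \<odot> c 0)"
    by (simp add: vmul_def vec_eq_iff complex_eq_iff)
  ultimately show ?thesis
    by (simp only: torus_act_def ax)
qed

lemma vertical_space_eq: "vertical_space v z = (\<lambda>\<xi>. imul (\<xi> \<odot> z)) ` lie_N v"
proof -
  have "vector_derivative (\<lambda>t. torus_act (t *\<^sub>R \<xi>) z) (at 0) = imul (((2 * pi) *\<^sub>R \<xi>) \<odot> z)" for \<xi>
    using torus_act_has_vector_derivative[of "\<lambda>_. z" 0 \<xi>] by (simp add: vector_derivative_at)
  then have "vertical_space v z = (\<lambda>\<xi>. imul (((2 * pi) *\<^sub>R \<xi>) \<odot> z)) ` lie_N v"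
    by (auto simp: vertical_space_def)
  also have "\<dots> = (\<lambda>\<xi>. imul (\<xi> \<odot> z)) ` (\<lambda>\<xi>. (2 * pi) *\<^sub>R \<xi>) ` lie_N v" by (simp add: image_image)
  also have "(\<lambda>\<xi>. (2 * pi) *\<^sub>R \<xi>) ` lie_N v = lie_N v"
  proof (intro equalityI subsetI)
    fix \<xi> assume "\<xi> \<in> lie_N v"
    then have "(1 / (2 * pi)) *\<^sub>R \<xi> \<in> lie_N v" by (intro subspace_scale subspace_lie_N)
    then show "\<xi> \<in> (\<lambda>\<xi>. (2 * pi) *\<^sub>R \<xi>) ` lie_N v" by (rule rev_image_eqI) simp
  qed (auto intro: subspace_scale subspace_lie_N)
  finally show ?thesis .
qed

lemma torus_act_level_Z: "z \<in> level_Z v lam \<Longrightarrow> torus_act t z \<in> level_Z v lam"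
  by (simp add: level_Z_def moment_T_def torus_act_def norm_mult)

lemma dim_lie_N:
  fixes v :: "'d::finite \<Rightarrow> real ^ 'n"
  shows "CARD('d) \<le> CARD('n) + dim (lie_N v)"
proof -
  let ?A = "range (adjoint (proj_pi v))"
  have lin: "linear (adjoint (proj_pi v))" by (rule adjoint_linear[OF linear_proj_pi])
  have "dim {y \<in> UNIV. \<forall>x\<in>?A. orthogonal x y} + dim ?A = dim (UNIV :: (real ^ 'd) set)"
    using linear_subspace_image[OF lin] by (intro dim_subspace_orthogonal_to_vectors) auto
  moreover have "{y \<in> UNIV. \<forall>x\<in>?A. orthogonal x y} = lie_N v"
    using ker_orthogonal_comp_adjoint[OF linear_proj_pi[of v]]
    by (auto simp: orthogonal_comp_def lie_N_def vimage_def)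
  moreover have "dim ?A \<le> CARD('n)" using dim_image_le[OF lin, of UNIV] by simp
  ultimately show ?thesis by simp
qed

lemma local_param_has_derivative:
  assumes "local_param v lam U s" "x \<in> U"
  shows "(s has_derivative (\<lambda>u. dir_deriv s x u)) (at x)"
  using assms by (auto simp: local_param_def intro: smooth_on_has_derivative)

text \<open>On the level set the function \<open>(\<Sum>j. \<xi>_j |z_j|^2)\<close> is constant for every \<open>\<xi> \<in> lie_N v\<close>;
  differentiate it along \<open>s\<close>.\<close>

lemma level_Z_derivative:
  assumes lp: "local_param v lam U s" and x: "x \<in> U" and \<xi>: "\<xi> \<in> lie_N v"
  shows "dir_deriv s x u \<bullet> (\<xi> \<odot> s x) = 0"
proof -
  have U: "open U" using lp by (simp add: local_param_def)
  have const: "s y \<bullet> (\<xi> \<odot> s y) = 2 * ((\<chi> j. lam j) \<bullet> \<xi>)" if "y \<in> U" for y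
  proof -
    have "moment_T lam (s y) \<bullet> \<xi> = 0" using lp that \<xi> by (auto simp: local_param_def level_Z_def)
    moreover have "moment_T lam (s y) = (\<chi> j. lam j) - (1/2) *\<^sub>R (\<chi> j. (cmod (s y $ j))\<^sup>2)"
      by (simp add: moment_T_def vec_eq_iff)
    ultimately show ?thesis
      by (simp add: inner_vmul_self inner_diff_left inner_commute[of \<xi>])
  qed
  note d = local_param_has_derivative[OF lp x]
  have "dir_deriv (\<lambda>y. s y \<bullet> (\<xi> \<odot> s y)) x u = s x \<bullet> (\<xi> \<odot> dir_deriv s x u) + dir_deriv s x u \<bullet> (\<xi> \<odot> s x)"
    by (rule dir_deriv_at[OF has_derivative_inner[OF d bounded_linear.has_derivative[OF vmul.bounded_linear_right d]]])
  moreover have "dir_deriv (\<lambda>y. s y \<bullet> (\<xi> \<odot> s y)) x u = dir_deriv (\<lambda>y. 2 * ((\<chi> j. lam j) \<bullet> \<xi>)) x u"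
    by (rule dir_deriv_cong[OF U x const])
  moreover have "s x \<bullet> (\<xi> \<odot> dir_deriv s x u) = dir_deriv s x u \<bullet> (\<xi> \<odot> s x)"
    by (metis inner_commute inner_vmul_left)
  ultimately show ?thesis by simp
qed

text \<open>The velocity of the curve \<open>s (x + t u)\<close> turned by the torus with angular velocity \<open>- \<xi>\<close>.
  Thus tangency of the horizontal vectors needs no description of the tangent space by
  equations.\<close>

lemma tangent_space_gauge:
  assumes lp: "local_param v lam U s" and x: "x \<in> U" and \<xi>: "\<xi> \<in> lie_N v"
  shows "dir_deriv s x u - imul (\<xi> \<odot> s x) \<in> tangent_space (level_Z v lam) (s x)"
proof -
  let ?\<zeta> = "(- 1 / (2 * pi)) *\<^sub>R \<xi>"
  \<comment> \<open>Freezing the base point at \<open>x\<close> when \<open>x + t u\<close> is outside \<open>U\<close> keeps the curve in the level set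
    for all real times.\<close>
  let ?\<gamma> = "\<lambda>t::real. torus_act (t *\<^sub>R ?\<zeta>) (s (if x + t *\<^sub>R u \<in> U then x + t *\<^sub>R u else x))"
  have U: "open U" using lp by (simp add: local_param_def)
  have "range ?\<gamma> \<subseteq> level_Z v lam"
    using lp x by (auto simp: local_param_def intro!: torus_act_level_Z)
  moreover have "?\<gamma> 0 = s x" by (simp add: torus_act_def)
  moreover have "(?\<gamma> has_vector_derivative (dir_deriv s x u - imul (\<xi> \<odot> s x))) (at 0)"
  proof -
    have d: "(s has_derivative (\<lambda>u. dir_deriv s x u)) (at (x + 0 *\<^sub>R u))"
      using local_param_has_derivative[OF lp x] by simp
    have "((\<lambda>t. x + t *\<^sub>R u) has_derivative (\<lambda>t. t *\<^sub>R u)) (at (0::real))"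
      by (auto intro!: derivative_eq_intros)
    from has_derivative_compose[OF this d]
    have "((\<lambda>t. s (x + t *\<^sub>R u)) has_vector_derivative dir_deriv s x u) (at 0)"
      using linear_scale[OF has_derivative_linear[OF d]] by (simp add: has_vector_derivative_def)
    from torus_act_has_vector_derivative[OF this, of ?\<zeta>]
    have t: "((\<lambda>t. torus_act (t *\<^sub>R ?\<zeta>) (s (x + t *\<^sub>R u))) has_vector_derivative
        (dir_deriv s x u - imul (\<xi> \<odot> s x))) (at 0)"
      by (simp add: vmul.scaleR_left vmul.minus_left imul_linear_simps)
    let ?T = "(\<lambda>t. x + t *\<^sub>R u) -` U"
    have "open ?T" by (intro open_vimage U continuous_intros)
    moreover have "0 \<in> ?T" using x by simp
    ultimately show ?thesis
      by (rule has_vector_derivative_transform_within_open[OF t]) simp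
  qed
  ultimately show ?thesis unfolding tangent_space_def by blast
qed

lemma vertical_decomposition:
  obtains \<xi> where "\<xi> \<in> lie_N v" "\<And>\<zeta>. \<zeta> \<in> lie_N v \<Longrightarrow> (w - imul (\<xi> \<odot> z)) \<bullet> imul (\<zeta> \<odot> z) = 0"
proof -
  let ?S = "(\<lambda>\<xi>. imul (\<xi> \<odot> z)) ` lie_N v"
  have "linear (\<lambda>\<xi>. imul (\<xi> \<odot> z))"
    by (rule linearI) (simp_all add: vmul.add_left vmul.scaleR_left imul_linear_simps)
  then have sub: "span ?S = ?S"
    using linear_subspace_image[OF _ subspace_lie_N] by (simp add: span_eq_iff[THEN iffD2])
  obtain y r where yr: "y \<in> span ?S" "\<And>w. w \<in> span ?S \<Longrightarrow> orthogonal r w" "w = y + r"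
    using orthogonal_subspace_decomp_exists by metis
  then obtain \<xi> where \<xi>: "\<xi> \<in> lie_N v" "y = imul (\<xi> \<odot> z)" using sub by auto
  have "(w - imul (\<xi> \<odot> z)) \<bullet> imul (\<zeta> \<odot> z) = 0" if "\<zeta> \<in> lie_N v" for \<zeta>
    using yr(2)[of "imul (\<zeta> \<odot> z)"] yr(3) \<xi> that sub by (auto simp: orthogonal_def)
  then show ?thesis using that \<xi>(1) by blast
qed

text \<open>The difference of two candidates is both vertical and orthogonal to the vertical space.\<close>

lemma lift_eq:
  assumes lp: "local_param v lam U s" and x: "x \<in> U" and \<xi>: "\<xi> \<in> lie_N v"
    and orth: "\<And>\<zeta>. \<zeta> \<in> lie_N v \<Longrightarrow> (dir_deriv s x u - imul (\<xi> \<odot> s x)) \<bullet> imul (\<zeta> \<odot> s x) = 0"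
  shows "lift v lam s x u = dir_deriv s x u - imul (\<xi> \<odot> s x)"
  unfolding lift_def horizontal_part_def
proof (rule the_equality)
  show "dir_deriv s x u - imul (\<xi> \<odot> s x) \<in> horizontal_space v lam (s x) \<and>
      dir_deriv s x u - (dir_deriv s x u - imul (\<xi> \<odot> s x)) \<in> vertical_space v (s x)"
    using tangent_space_gauge[OF lp x \<xi>] orth \<xi>
    by (auto simp: horizontal_space_def vertical_space_eq)
  fix h assume h: "h \<in> horizontal_space v lam (s x) \<and> dir_deriv s x u - h \<in> vertical_space v (s x)"
  then obtain \<zeta> where \<zeta>: "\<zeta> \<in> lie_N v" "dir_deriv s x u - h = imul (\<zeta> \<odot> s x)"
    by (auto simp: vertical_space_eq)
  let ?d = "h - (dir_deriv s x u - imul (\<xi> \<odot> s x))"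
  have "?d = imul (\<xi> \<odot> s x) - imul (\<zeta> \<odot> s x)" unfolding \<zeta>(2)[symmetric] by simp
  then have d: "?d = imul ((\<xi> - \<zeta>) \<odot> s x)" by (simp add: vmul.diff_left imul_linear_simps)
  have "\<xi> - \<zeta> \<in> lie_N v" using \<xi> \<zeta> by (intro subspace_diff subspace_lie_N)
  then have "h \<bullet> imul ((\<xi> - \<zeta>) \<odot> s x) = 0"
    "(dir_deriv s x u - imul (\<xi> \<odot> s x)) \<bullet> imul ((\<xi> - \<zeta>) \<odot> s x) = 0"
    using h orth by (auto simp: horizontal_space_def vertical_space_eq)
  then have "?d \<bullet> ?d = 0" unfolding d[symmetric] by (simp add: inner_diff_left[of h])
  then show "h = dir_deriv s x u - imul (\<xi> \<odot> s x)" by simp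
qed

theorem theorem3p4:
  fixes \<Delta> :: "(real ^ 'n) set"
    and v :: "'d::finite \<Rightarrow> real ^ 'n"
    and lam :: "'d \<Rightarrow> real"
  assumes "delzant_polytope \<Delta>"
    and "facet_presentation \<Delta> v lam"
  shows "\<forall>p \<in> toric_M v lam. \<forall>U s. local_param v lam U s \<longrightarrow>
           (\<forall>x\<in>U. orbit_N v (s x) = p \<longrightarrow>
             (\<forall>V. V \<noteq> 0 \<longrightarrow>
               hol_sect_curv (toric_metric v lam s) (toric_J v lam s) x V > 0))"
proof (intro ballI allI impI)
  fix U :: "(complex ^ 'n) set" and s :: "complex ^ 'n \<Rightarrow> complex ^ 'd" and x V :: "complex ^ 'n"
  assume lp: "local_param v lam U s" and x: "x \<in> U" and V: "V \<noteq> 0"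
  let ?g = "toric_metric v lam s"
  have "\<exists>\<xi>. \<xi> \<in> lie_N v \<and> (\<forall>\<zeta>\<in>lie_N v. (dir_deriv s y u - imul (\<xi> \<odot> s y)) \<bullet> imul (\<zeta> \<odot> s y) = 0)" for y u
    using vertical_decomposition[of v "dir_deriv s y u" "s y"] by metis
  then obtain \<eta> where \<eta>: "\<And>y u. \<eta> y u \<in> lie_N v"
    "\<And>y u \<zeta>. \<zeta> \<in> lie_N v \<Longrightarrow> (dir_deriv s y u - imul (\<eta> y u \<odot> s y)) \<bullet> imul (\<zeta> \<odot> s y) = 0"
    by metis
  have lift: "lift v lam s y u = dir_deriv s y u - imul (\<eta> y u \<odot> s y)" if "y \<in> U" for y u
    using lift_eq[OF lp that \<eta>(1) \<eta>(2)] .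
  interpret torus_quotient_chart v U s \<eta> ?g
  proof
    show "open U" "smooth_on U s" using lp by (auto simp: local_param_def)
    show "\<eta> y u \<in> lie_N v" for y u by (rule \<eta>(1))
    show "(dir_deriv s y u - imul (\<eta> y u \<odot> s y)) \<bullet> imul (\<xi> \<odot> s y) = 0"
      if "\<xi> \<in> lie_N v" for y u \<xi> by (rule \<eta>(2)[OF that])
    show "dir_deriv s y u \<bullet> (\<xi> \<odot> s y) = 0" if "y \<in> U" "\<xi> \<in> lie_N v" for y u \<xi>
      by (rule level_Z_derivative[OF lp that])
    show "\<xi> = 0" if "y \<in> U" "\<xi> \<in> lie_N v" "\<xi> \<odot> s y = 0" for y \<xi>
    proof (rule level_Z_free[OF assms _ that(2)])
      show "s y \<in> level_Z v lam" using lp that by (auto simp: local_param_def)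
      show "\<xi> $ j = 0" if "s y $ j \<noteq> 0" for j
        using arg_cong[OF \<open>\<xi> \<odot> s y = 0\<close>, of "\<lambda>z. z $ j"] that by (simp add: vmul_def)
    qed
    show "u = 0" if "y \<in> U" "dir_deriv s y u = imul (\<eta> y u \<odot> s y)" for y u
      using lp that \<eta>(1)[of y u] by (auto simp: local_param_def vertical_space_eq)
    show "2 * CARD('d) \<le> DIM(complex ^ 'n) + 2 * dim (lie_N v)"
      using dim_lie_N[of v] by simp
    show "?g y u w = (dir_deriv s y u - imul (\<eta> y u \<odot> s y)) \<bullet> (dir_deriv s y w - imul (\<eta> y w \<odot> s y))"
      if "y \<in> U" for y u w
      by (simp add: toric_metric_def lift[OF that])
  qed
  have liftL: "lift v lam s x u = L x u" for u by (simp add: lift[OF x] L_def')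
  obtain W where W: "L x W = imul (L x V)" using range_L_imul[OF x] by blast
  have J: "toric_J v lam s x V = W"
    unfolding toric_J_def liftL using W inj_L[OF x] by (intro the_equality) (auto simp: inj_def)
  obtain \<beta> where \<beta>: "\<beta> \<in> lie_N v"
    "riemann_tensor ?g x V W W V = 4 * ((\<beta> \<odot> s x) \<bullet> (\<beta> \<odot> s x))"
    "\<And>\<xi>. \<xi> \<in> lie_N v \<Longrightarrow> (\<beta> \<odot> s x) \<bullet> (\<xi> \<odot> s x) = - (L x V \<bullet> (\<xi> \<odot> L x V))"
    using riemann_holomorphic[OF x W] by blast
  have LV: "L x V \<noteq> 0" using V inj_L[OF x] linear_injective_0[OF linear_L[OF x]] by auto
  have "\<beta> \<odot> s x \<noteq> 0"
  proof
    assume z: "\<beta> \<odot> s x = 0"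
    have "(\<chi> j. (cmod (L x V $ j))\<^sup>2) = 0"
      by (rule delzant_recession_trivial[OF assms])
         (use \<beta>(3) z in \<open>auto simp: inner_vmul_self inner_commute\<close>)
    then have "L x V = 0" by (simp add: vec_eq_iff)
    then show False using LV by simp
  qed
  then have "riemann_tensor ?g x V W W V > 0" unfolding \<beta>(2) by simp
  moreover have "?g x V V > 0" using LV by (simp add: toric_metric_def liftL)
  ultimately show "hol_sect_curv ?g (toric_J v lam s) x V > 0"
    unfolding hol_sect_curv_def J by simp
qed

end
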